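(* Let $0<p<\infty$, $0<q,r\le\infty$ and $\beta\in\mathbb{R}$. Then for $\lambda>1$, $0<M<\min\{p,q,r\}$ and every measurable function $f$ on $\mathbb{R}^{d+1}_+$ we have $$\bigg\|\bigg(\int_0^\infty\bigg(⨍_{t/2}^t t^{-d}\int_{B(\cdot,\lambda t)}|s^{-\beta}f(s,y)|^r\,\mathrm{d}y\,\mathrm{d}s\bigg)^{\frac qr}\frac{\mathrm{d}t}{t}\bigg)^{\frac1q}\bigg\|_{L^p(\mathbb{R}^d)}\lesssim\lambda^{\frac dM}\|f\|_{\mathrm T^{p,q,r}_\beta},$$ where the implicit constant depends on $d,M,p,q,r$.
   Context: The symbol ⨍ denotes the mean-value integral and $B(x,t)$ the open ball in $\mathbb{R}^d$; $\mathbb{R}^{d+1}_+=(0,\infty)\times\mathbb{R}^d$. For $0<p<\infty$, $0<q,r\le\infty$, $\beta\in\mathbb{R}$, $$\|f\|_{\mathrm T^{p,q,r}_\beta}=\bigg\|\bigg(\int_0^\infty\bigg(⨍_{t/2}^t⨍_{B(\cdot,t)}|s^{-\beta}f(s,y)|^r\,\mathrm{d}y\,\mathrm{d}s\bigg)^{q/r}\frac{\mathrm{d}t}{t}\bigg)^{1/q}\bigg\|_{L^p(\mathbb{R}^d)}.$$ If $q$ or $r$ is infinite, the corresponding integral expression (also in the claim) is replaced by an essential supremum over the same domain: over $t>0$ for $q=\infty$; over $(\frac t2,t]\times B(\cdot,t)$, respectively $(\frac t2,t]\times B(\cdot,\lambda t)$, for $r=\infty$. *)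

theory Defs
  imports "HOL-Analysis.Analysis" "HOL-Probability.Essential_Supremum"
begin

text \<open>
  All (quasi-)norms take values in \<^typ>\<open>ennreal\<close>, so that no finiteness is presupposed, and
  all integrals and essential suprema refer to Lebesgue measure.
\<close>

definition upper_half_space :: "(real \<times> (real ^ 'n)) set" where
  "upper_half_space = {0<..} \<times> UNIV"

text \<open>Only used for exponents \<open>a > 0\<close>, whence the value at \<open>\<infinity>\<close>.\<close>

definition ennreal_powr :: "ennreal \<Rightarrow> real \<Rightarrow> ennreal" where
  "ennreal_powr x a = (if x = \<infinity> then \<infinity> else ennreal (enn2real x powr a))"

definition mean_integral :: "'a::euclidean_space set \<Rightarrow> ('a \<Rightarrow> ennreal) \<Rightarrow> ennreal" where
  "mean_integral A g = (\<integral>\<^sup>+x\<in>A. g x \<partial>lebesgue) / emeasure lebesgue A"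

definition weighted_abs :: "real \<Rightarrow> (real \<times> (real ^ 'n) \<Rightarrow> complex) \<Rightarrow> real \<times> (real ^ 'n) \<Rightarrow> real" where
  "weighted_abs \<beta> f = (\<lambda>(s, y). cmod (of_real (s powr (- \<beta>)) * f (s, y)))"

text \<open>
  The two inner expressions, over \<open>B(x,t)\<close> and over \<open>B(x,lam t)\<close>. The outer exponent \<open>q/r\<close> of the
  finite case is split as \<open>(1/r) \<cdot> q\<close>: the factor \<open>1/r\<close> is applied here and \<open>q\<close> in
  \<open>vertical_norm\<close>, so that the cases \<open>q = \<infinity>\<close> and \<open>r = \<infinity>\<close> can be treated independently.
  The second expression is normalised by \<open>t\<^sup>-\<^sup>d\<close>, not by the volume of \<open>B(x,lam t)\<close>; for
  \<open>r = \<infinity>\<close> there is no normalisation.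
\<close>

definition tent_inner ::
  "ennreal \<Rightarrow> real \<Rightarrow> (real \<times> (real ^ 'n) \<Rightarrow> complex) \<Rightarrow> real ^ 'n \<Rightarrow> real \<Rightarrow> ennreal" where
  "tent_inner r \<beta> f x t =
    (if r = \<infinity>
     then esssup (lebesgue_on ({t/2<..t} \<times> ball x t)) (\<lambda>z. ennreal (weighted_abs \<beta> f z))
     else ennreal_powr
       (mean_integral {t/2<..t} (\<lambda>s.
          mean_integral (ball x t) (\<lambda>y. ennreal (weighted_abs \<beta> f (s, y) powr enn2real r))))
       (1 / enn2real r))"

definition tent_inner_wide ::
  "real \<Rightarrow> ennreal \<Rightarrow> real \<Rightarrow> (real \<times> (real ^ 'n) \<Rightarrow> complex) \<Rightarrow> real ^ 'n \<Rightarrow> real \<Rightarrow> ennreal" where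
  "tent_inner_wide lam r \<beta> f x t =
    (if r = \<infinity>
     then esssup (lebesgue_on ({t/2<..t} \<times> ball x (lam * t))) (\<lambda>z. ennreal (weighted_abs \<beta> f z))
     else ennreal_powr
       (mean_integral {t/2<..t} (\<lambda>s.
          ennreal (t powr (- real CARD('n))) *
          (\<integral>\<^sup>+y\<in>ball x (lam * t). ennreal (weighted_abs \<beta> f (s, y) powr enn2real r) \<partial>lebesgue)))
       (1 / enn2real r))"

definition vertical_norm :: "ennreal \<Rightarrow> (real \<Rightarrow> ennreal) \<Rightarrow> ennreal" where
  "vertical_norm q G =
    (if q = \<infinity>
     then esssup (lebesgue_on {0<..}) G
     else ennreal_powr
       (\<integral>\<^sup>+t\<in>{0<..}. ennreal_powr (G t) (enn2real q) / ennreal t \<partial>lebesgue)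
       (1 / enn2real q))"

definition Lp_norm :: "real \<Rightarrow> (real ^ 'n \<Rightarrow> ennreal) \<Rightarrow> ennreal" where
  "Lp_norm p F = ennreal_powr (\<integral>\<^sup>+x. ennreal_powr (F x) p \<partial>lebesgue) (1 / p)"

definition tent_norm ::
  "real \<Rightarrow> ennreal \<Rightarrow> ennreal \<Rightarrow> real \<Rightarrow> (real \<times> (real ^ 'n) \<Rightarrow> complex) \<Rightarrow> ennreal" where
  "tent_norm p q r \<beta> f = Lp_norm p (\<lambda>x. vertical_norm q (tent_inner r \<beta> f x))"

end

theory Submission
  imports Defs
begin


text \<open>
  Write \<open>g(x,t)\<close> for the expression over \<open>B(x,t)\<close> and \<open>W(x,t)\<close> for the one over \<open>B(x,lam t)\<close>. Covering
  \<open>B(x,lam t)\<close> by balls of radius \<open>t/2\<close> and using \<open>\<ell>\<^sup>M \<subseteq> \<ell>\<^sup>r\<close> (here \<open>M < r\<close> enters) gives the pointwise bound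
  \<open>W(x,t) \<le> C lam\<^bsup>d/M\<^esup> (A\<^sub>t(g(\<cdot>,t)\<^sup>M)(x))\<^bsup>1/M\<^esup>\<close>, where \<open>A\<^sub>t\<close> averages over balls of radius \<open>3 lam t\<close>.
  With \<open>P = p/M > 1\<close> and \<open>Q = q/M > 1\<close> it remains to bound \<open>(G\<^sub>t) \<mapsto> (A\<^sub>t G\<^sub>t)\<close> on \<open>L\<^sup>P(L\<^sup>Q(dt/t))\<close> uniformly
  in the radii. Since the radius is prescribed for each \<open>t\<close>, the vector-valued maximal theorem is not
  needed, only the scalar one: for \<open>Q = P\<close> the claim is Jensen and Fubini, for \<open>Q = \<infinity>\<close> it follows
  from \<open>A\<^sub>t G\<^sub>t \<le> 2\<^sup>d Max(sup\<^sub>t G\<^sub>t)\<close> with the maximal function \<open>Max\<close>, for \<open>P < Q < \<infinity>\<close> one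
  interpolates by an explicit factorisation, and for \<open>Q < P\<close> one dualises.
\<close>

section \<open>Powers of extended nonnegative reals\<close>

text \<open>The exponents p and q may be below 1, where averaging need not be bounded. For M-th
  powers both exponents exceed 1; the price is the M-th root of a volume ratio of order lam^d, which
  accounts for lam^(d/M). The averages over the large balls must then be bounded with a constant
  free of lam. This works because averaging over balls of one radius is self-adjoint, contracts L^1,
  and is dominated by the maximal function whatever the radius. Two obstacles shape the details.
  Since \<open>f\<close> is only Lebesgue measurable and the radii vary with t, exchanging integrals
  requires joint measurability, so \<open>f\<close> is first replaced by a Borel representative.
  Since norms may be infinite, every cancellation needs a truncation or a case distinction.\<close>

lemma ennreal_powr_ennreal:
  "0 \<le> w \<Longrightarrow> ennreal_powr (ennreal w) a = ennreal (w powr a)"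
  by (simp add: ennreal_powr_def)

lemma ennreal_powr_top [simp]: "ennreal_powr \<infinity> a = \<infinity>" "ennreal_powr top a = top"
  by (simp_all add: ennreal_powr_def)

lemma ennreal_powr_0 [simp]: "ennreal_powr 0 a = 0"
  by (simp add: ennreal_powr_def)

lemma ennreal_powr_one [simp]: "ennreal_powr 1 a = 1"
  by (simp add: ennreal_powr_def)

lemma ennreal_powr_1 [simp]: "ennreal_powr x 1 = x"
  by (cases x) (auto simp: ennreal_powr_ennreal)

lemma ennreal_powr_mono: "x \<le> y \<Longrightarrow> 0 \<le> a \<Longrightarrow> ennreal_powr x a \<le> ennreal_powr y a"
  by (cases x; cases y) (auto simp: ennreal_powr_ennreal powr_mono2 ennreal_leI top_unique)

lemma ennreal_powr_powr: 
  "ennreal_powr (ennreal_powr x a) b = ennreal_powr x (a * b)"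
  by (cases x) (auto simp: ennreal_powr_ennreal powr_powr)

lemma ennreal_powr_inverse [simp]:
  "0 < a \<Longrightarrow> ennreal_powr (ennreal_powr x a) (1 / a) = x"
  "0 < a \<Longrightarrow> ennreal_powr (ennreal_powr x (1 / a)) a = x"
  by (simp_all add: ennreal_powr_powr)

lemma ennreal_powr_le_iff:
  "0 < a \<Longrightarrow> ennreal_powr x a \<le> y \<longleftrightarrow> x \<le> ennreal_powr y (1 / a)"
  by (metis divide_nonneg_pos ennreal_powr_inverse(1,2) ennreal_powr_mono less_eq_real_def zero_le_one)

lemma ennreal_powr_add:
  "0 < a \<Longrightarrow> 0 < b \<Longrightarrow> ennreal_powr x (a + b) = ennreal_powr x a * ennreal_powr x b"
  by (cases x) (auto simp: ennreal_powr_ennreal powr_add ennreal_mult ennreal_top_mult)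

lemma ennreal_powr_eq_0_iff [simp]: "ennreal_powr x a = 0 \<longleftrightarrow> x = 0"
  by (cases x) (auto simp: ennreal_powr_ennreal)

lemma ennreal_powr_eq_top_iff [simp]: "ennreal_powr x a = top \<longleftrightarrow> x = top"
  by (cases x) (auto simp: ennreal_powr_ennreal)

lemma ennreal_powr_mult:
  "ennreal_powr (x * y) a = ennreal_powr x a * ennreal_powr y a"
proof (cases "x = top \<or> y = top")
  case True
  then show ?thesis
    by (cases "x = 0 \<or> y = 0") (auto simp: ennreal_mult_eq_top_iff ennreal_top_mult ennreal_mult_top)
next
  case False
  then show ?thesis
    by (cases x; cases y)
      (auto simp: ennreal_powr_ennreal powr_mult ennreal_mult simp flip: ennreal_mult)
qed

lemma borel_measurable_ennreal_powr [measurable]: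
  assumes [measurable]: "f \<in> borel_measurable N"
  shows "(\<lambda>x. ennreal_powr (f x) a) \<in> borel_measurable N"
  unfolding ennreal_powr_def by measurable

text \<open>By \<open>ennreal_powr_le_iff\<close> a positive power is an order isomorphism with the
  reciprocal power as inverse, so suprema are preserved. This carries truncations to the limit under
  a power.\<close>

lemma SUP_ennreal_powr:
  assumes a: "0 < a"
  shows "(SUP i\<in>I. ennreal_powr (f i) a) = ennreal_powr (SUP i\<in>I. f i) a"
proof (rule antisym)
  show "(SUP i\<in>I. ennreal_powr (f i) a) \<le> ennreal_powr (SUP i\<in>I. f i) a"
    using a by (intro SUP_least ennreal_powr_mono SUP_upper) auto
  have "f i \<le> ennreal_powr (SUP i\<in>I. ennreal_powr (f i) a) (1 / a)" if "i \<in> I" for i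
    using that by (auto simp flip: ennreal_powr_le_iff[OF a] intro: SUP_upper)
  then show "ennreal_powr (SUP i\<in>I. f i) a \<le> (SUP i\<in>I. ennreal_powr (f i) a)"
    by (simp add: ennreal_powr_le_iff[OF a] SUP_least)
qed

section \<open>Young, Hoelder and Jensen inequalities\<close>

lemma ennreal_young:
  fixes x y :: ennreal
  assumes "0 < a" "a < 1"
  shows "ennreal_powr x a * ennreal_powr y (1 - a) \<le> ennreal a * x + ennreal (1 - a) * y"
proof (cases "x = top \<or> y = top")
  case True
  then show ?thesis using assms by (auto simp: ennreal_mult_top)
next
  case False
  then obtain u v where uv: "x = ennreal u" "y = ennreal v" "0 \<le> u" "0 \<le> v"
    by (cases x; cases y) auto
  have "u powr a * v powr (1 - a) \<le> a * u + (1 - a) * v"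
    using Youngs_inequality_0[of a "1 - a" u v] assms uv
    by (cases "u = 0 \<or> v = 0") auto
  then have "ennreal (u powr a * v powr (1 - a)) \<le> ennreal (a * u + (1 - a) * v)"
    by (rule ennreal_leI)
  then show ?thesis using assms uv
    by (simp add: ennreal_powr_ennreal ennreal_mult ennreal_plus)
qed

text \<open>Once both integrals are scaled to 1, integrate \<open>ennreal_young\<close>. Weights a
  and 1 - a, instead of conjugate exponents, suit duality and interpolation alike.\<close>

lemma nn_integral_Hoelder:
  assumes [measurable]: "f \<in> borel_measurable N" "g \<in> borel_measurable N"
    and a: "0 < a" "a < 1"
  shows "(\<integral>\<^sup>+x. ennreal_powr (f x) a * ennreal_powr (g x) (1 - a) \<partial>N)
    \<le> ennreal_powr (\<integral>\<^sup>+x. f x \<partial>N) a * ennreal_powr (\<integral>\<^sup>+x. g x \<partial>N) (1 - a)"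
proof -
  let ?F = "\<integral>\<^sup>+x. f x \<partial>N" and ?G = "\<integral>\<^sup>+x. g x \<partial>N"
  consider "?F = 0 \<or> ?G = 0" | "?F \<noteq> 0" "?G \<noteq> 0" "?F = top \<or> ?G = top"
    | "?F \<noteq> 0" "?G \<noteq> 0" "?F \<noteq> top" "?G \<noteq> top" by blast
  then show ?thesis
  proof cases
    case 1
    then have "AE x in N. ennreal_powr (f x) a * ennreal_powr (g x) (1 - a) = 0"
      by (auto simp: nn_integral_0_iff_AE)
    then have "(\<integral>\<^sup>+x. ennreal_powr (f x) a * ennreal_powr (g x) (1 - a) \<partial>N) = 0"
      by (simp add: nn_integral_0_iff_AE)
    then show ?thesis by simp
  next
    case 2
    then show ?thesis using a by (auto simp: ennreal_mult_top ennreal_top_mult)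
  next
    case 3
    \<comment> \<open>Both integrals are positive and finite here, so they can be normalised;
      \<open>?K\<close> undoes the normalisation.\<close>
    define c d where "c = inverse ?F" and "d = inverse ?G"
    have c: "c * ?F = 1" "?F * c = 1" and d: "d * ?G = 1" "?G * d = 1"
      using 3 by (auto simp: c_def d_def ennreal_mult_divide_eq mult.commute top.not_eq_extremum
          divide_ennreal_def[symmetric] ennreal_divide_self)
    let ?K = "ennreal_powr ?F a * ennreal_powr ?G (1 - a)"
    have *: "?K * (ennreal_powr (c * u) a * ennreal_powr (d * v) (1 - a))
       = ennreal_powr u a * ennreal_powr v (1 - a)" for u v
    proof -
      have "?K * (ennreal_powr (c * u) a * ennreal_powr (d * v) (1 - a))
        = ennreal_powr (?F * c) a * ennreal_powr (?G * d) (1 - a) * (ennreal_powr u a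
            * ennreal_powr v (1 - a))"
        unfolding ennreal_powr_mult by (simp only: ac_simps)
      then show ?thesis by (simp add: c d)
    qed
    have "(\<integral>\<^sup>+x. ennreal_powr (f x) a * ennreal_powr (g x) (1 - a) \<partial>N)
      = (\<integral>\<^sup>+x. ?K * (ennreal_powr (c * f x) a * ennreal_powr (d * g x) (1 - a)) \<partial>N)"
      by (simp only: *)
    also have "\<dots> \<le> (\<integral>\<^sup>+x. ?K * (ennreal a * (c * f x) + ennreal (1 - a) * (d * g x)) \<partial>N)"
      by (intro nn_integral_mono mult_left_mono ennreal_young a) auto
    also have "\<dots> = ?K * (ennreal a * (c * ?F) + ennreal (1 - a) * (d * ?G))"
      by (simp add: nn_integral_cmult nn_integral_add)
    also have "\<dots> = ?K"
      using a by (simp add: c d ennreal_plus[symmetric] del: ennreal_plus)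
    finally show ?thesis .
  qed
qed

text \<open>Hoelder against the constant 1. Mass at most 1, rather than equal to 1, also covers the
  zero kernel of a ball with nonpositive radius.\<close>

lemma nn_integral_Jensen_powr:
  assumes [measurable]: "f \<in> borel_measurable N"
    and N: "emeasure N (space N) \<le> 1" and Q: "1 \<le> Q"
  shows "ennreal_powr (\<integral>\<^sup>+x. f x \<partial>N) Q \<le> (\<integral>\<^sup>+x. ennreal_powr (f x) Q \<partial>N)"
proof (cases "Q = 1")
  case False
  with Q have Q: "1 < Q" by simp
  have "(\<integral>\<^sup>+x. f x \<partial>N)
      = (\<integral>\<^sup>+x. ennreal_powr (ennreal_powr (f x) Q) (1 / Q) * ennreal_powr 1 (1 - 1 / Q) \<partial>N)"
    using Q by simp
  also have "\<dots> \<le> ennreal_powr (\<integral>\<^sup>+x. ennreal_powr (f x) Q \<partial>N) (1 / Q)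
       * ennreal_powr (\<integral>\<^sup>+x. 1 \<partial>N) (1 - 1 / Q)"
    using Q by (intro nn_integral_Hoelder) auto
  also have "\<dots> \<le> ennreal_powr (\<integral>\<^sup>+x. ennreal_powr (f x) Q \<partial>N) (1 / Q) * ennreal_powr 1 (1 - 1 / Q)"
    using Q N by (intro mult_left_mono ennreal_powr_mono) auto
  finally show ?thesis
    using Q by (simp add: ennreal_powr_le_iff)
qed simp


lemma ennreal_mult_inverse_self: "0 < v \<Longrightarrow> ennreal v * inverse (ennreal v) = 1"
  by (simp add: inverse_ennreal ennreal_mult[symmetric])

section \<open>The Hardy-Littlewood maximal function\<close>

text \<open>Dividing by the volume of the ball about 0, the same number as for the ball about
  \<open>x\<close>, makes the symmetry in \<open>x\<close> and \<open>y\<close> evident. As a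
  kernel, the average is open to Tonelli and to joint measurability in radius and centre.\<close>

definition ball_kernel :: "real \<Rightarrow> 'a::euclidean_space \<Rightarrow> 'a \<Rightarrow> ennreal" where
  "ball_kernel \<rho> x y = indicator (ball x \<rho>) y * inverse (emeasure lborel (ball (0::'a) \<rho>))"

definition ball_avg :: "real \<Rightarrow> ('a::euclidean_space \<Rightarrow> ennreal) \<Rightarrow> 'a \<Rightarrow> ennreal" where
  "ball_avg \<rho> h x = (\<integral>\<^sup>+y. ball_kernel \<rho> x y * h y \<partial>lborel)"

text \<open>The centred Hardy-Littlewood maximal function over rational radii: a countable supremum
  stays measurable, and \<open>ball_avg_le_max_fun\<close> recovers all radii at the cost of
  2^d.\<close>

definition max_fun :: "('a::euclidean_space \<Rightarrow> ennreal) \<Rightarrow> 'a \<Rightarrow> ennreal" where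
  "max_fun h x = (SUP \<rho>\<in>\<rat> \<inter> {0<..}. ball_avg \<rho> h x)"

text \<open>The \<open>max\<close> gives one formula for all real radii, from which measurability in
  the radius can be read off.\<close>

lemma emeasure_ball_max:
  "emeasure lborel (ball (c::'a::euclidean_space) \<rho>)
      = ennreal (unit_ball_vol (DIM('a)) * max 0 \<rho> ^ DIM('a))"
  by (cases "0 \<le> \<rho>") (auto simp: emeasure_ball max_def not_le ball_empty)

lemma ball_kernel_sym: "ball_kernel \<rho> x y = ball_kernel \<rho> y x"
  by (auto simp: ball_kernel_def indicator_def dist_commute)

lemma borel_measurable_ball_kernel [measurable]:
  fixes f g :: "'b \<Rightarrow> 'a::euclidean_space"
  assumes [measurable]: "r \<in> borel_measurable N" "f \<in> borel_measurable N" "g \<in> borel_measurable N"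
  shows "(\<lambda>w. ball_kernel (r w) (f w) (g w)) \<in> borel_measurable N"
  unfolding ball_kernel_def emeasure_ball_max indicator_def mem_ball by measurable

lemma borel_measurable_ball_avg [measurable]:
  fixes f :: "'b \<Rightarrow> 'a::euclidean_space"
  assumes [measurable]: "r \<in> borel_measurable N" "f \<in> borel_measurable N"
    "(\<lambda>(w, y). G w y) \<in> borel_measurable (N \<Otimes>\<^sub>M lborel)"
  shows "(\<lambda>w. ball_avg (r w) (G w) (f w)) \<in> borel_measurable N"
  unfolding ball_avg_def by measurable

lemma borel_measurable_max_fun [measurable]:
  fixes h :: "'a::euclidean_space \<Rightarrow> ennreal"
  assumes [measurable]: "h \<in> borel_measurable borel"
  shows "max_fun h \<in> borel_measurable borel"
  unfolding max_fun_def[abs_def]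
  by (intro borel_measurable_SUP) (auto simp: countable_rat countable_Int1 intro!: borel_measurable_ball_avg)

lemma nn_integral_ball_kernel_eq_1:
  assumes "0 < \<rho>"
  shows "(\<integral>\<^sup>+y. ball_kernel \<rho> (x::'a::euclidean_space) y \<partial>lborel) = 1"
proof -
  define v where "v = unit_ball_vol (real DIM('a)) * \<rho> ^ DIM('a)"
  have v: "emeasure lborel (ball z \<rho>) = ennreal v" "0 < v" for z :: 'a
    using assms by (auto simp: v_def emeasure_ball)
  have "(\<integral>\<^sup>+y. ball_kernel \<rho> x y \<partial>lborel) = emeasure lborel (ball x \<rho>)
      * inverse (emeasure lborel (ball (0::'a) \<rho>))"
    unfolding ball_kernel_def by (subst nn_integral_multc) (auto intro!: borel_measurable_indicator)
  then show ?thesis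
    using v(2) unfolding v(1) by (simp only: ennreal_mult_inverse_self)
qed

lemma nn_integral_ball_kernel_le_1:
  "(\<integral>\<^sup>+y. ball_kernel \<rho> (x::'a::euclidean_space) y \<partial>lborel) \<le> 1"
proof (cases "0 < \<rho>")
  case False
  then show ?thesis by (simp add: ball_kernel_def ball_empty)
qed (simp add: nn_integral_ball_kernel_eq_1)

lemma ball_avg_altdef:
  fixes h :: "'a::euclidean_space \<Rightarrow> ennreal"
  assumes [measurable]: "h \<in> borel_measurable borel"
  shows "ball_avg \<rho> h x = inverse (emeasure lborel (ball x \<rho>)) * (\<integral>\<^sup>+y\<in>ball x \<rho>. h y \<partial>lborel)"
proof -
  have "ball_avg \<rho> h x = (\<integral>\<^sup>+y. inverse (emeasure lborel (ball x \<rho>)) * (h y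
      * indicator (ball x \<rho>) y) \<partial>lborel)"
    unfolding ball_avg_def ball_kernel_def emeasure_ball_max by (simp add: ac_simps)
  also have "\<dots> = inverse (emeasure lborel (ball x \<rho>)) * (\<integral>\<^sup>+y\<in>ball x \<rho>. h y \<partial>lborel)"
    by (rule nn_integral_cmult) (auto intro!: borel_measurable_times_ennreal borel_measurable_indicator)
  finally show ?thesis .
qed

lemma ball_avg_mono: "(\<And>y. h y \<le> k y) \<Longrightarrow> ball_avg \<rho> h x \<le> ball_avg \<rho> k x"
  unfolding ball_avg_def by (intro nn_integral_mono mult_left_mono) auto

lemma ball_avg_mono_AE: "AE y in lborel. h y \<le> k y \<Longrightarrow> ball_avg \<rho> h x \<le> ball_avg \<rho> k x"
  unfolding ball_avg_def by (rule nn_integral_mono_AE) (auto elim!: eventually_mono intro: mult_left_mono)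

text \<open>An average is an integral against a measure of mass at most 1, so
  \<open>nn_integral_Hoelder\<close> and \<open>nn_integral_Jensen_powr\<close> apply to it.\<close>

lemma ball_avg_density:
  fixes h :: "'a::euclidean_space \<Rightarrow> ennreal"
  assumes [measurable]: "h \<in> borel_measurable borel"
  shows "ball_avg \<rho> h x = (\<integral>\<^sup>+y. h y \<partial>density lborel (ball_kernel \<rho> x))"
  unfolding ball_avg_def by (subst nn_integral_density) auto

lemma ball_avg_add:
  fixes h k :: "'a::euclidean_space \<Rightarrow> ennreal"
  assumes [measurable]: "h \<in> borel_measurable borel" "k \<in> borel_measurable borel"
  shows "ball_avg \<rho> (\<lambda>y. h y + k y) x = ball_avg \<rho> h x + ball_avg \<rho> k x"
  by (simp add: ball_avg_density nn_integral_add)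

lemma ball_avg_const_le: "ball_avg \<rho> (\<lambda>_. c) (x::'a::euclidean_space) \<le> c"
proof -
  have "ball_avg \<rho> (\<lambda>_. c) x = (\<integral>\<^sup>+y. ball_kernel \<rho> x y \<partial>lborel) * c"
    unfolding ball_avg_def by (simp add: nn_integral_multc)
  also have "\<dots> \<le> 1 * c"
    by (intro mult_right_mono nn_integral_ball_kernel_le_1) auto
  finally show ?thesis by simp
qed

lemma ball_avg_Jensen:
  fixes h :: "'a::euclidean_space \<Rightarrow> ennreal"
  assumes [measurable]: "h \<in> borel_measurable borel" and "1 \<le> Q"
  shows "ennreal_powr (ball_avg \<rho> h x) Q \<le> ball_avg \<rho> (\<lambda>y. ennreal_powr (h y) Q) x"
  using nn_integral_ball_kernel_le_1[of \<rho> x] assms(2)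
  by (simp add: ball_avg_density nn_integral_Jensen_powr emeasure_density)

lemma ball_avg_Hoelder:
  fixes h k :: "'a::euclidean_space \<Rightarrow> ennreal"
  assumes [measurable]: "h \<in> borel_measurable borel" "k \<in> borel_measurable borel"
    and a: "0 < a" "a < 1"
  shows "ball_avg \<rho> (\<lambda>y. ennreal_powr (h y) a * ennreal_powr (k y) (1 - a)) x
    \<le> ennreal_powr (ball_avg \<rho> h x) a * ennreal_powr (ball_avg \<rho> k x) (1 - a)"
  using a by (simp add: ball_avg_density nn_integral_Hoelder)

text \<open>Tonelli and \<open>ball_kernel_sym\<close>. Self-adjointness yields the L^1 contraction,
  moves averages onto dual functions, and replaces a discrete covering in
  \<open>wide_integral_le\<close>.\<close>

lemma nn_integral_ball_avg:
  fixes h k :: "'a::euclidean_space \<Rightarrow> ennreal"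
  assumes [measurable]: "h \<in> borel_measurable borel" "k \<in> borel_measurable borel"
  shows "(\<integral>\<^sup>+x. ball_avg \<rho> h x * k x \<partial>lborel) = (\<integral>\<^sup>+x. h x * ball_avg \<rho> k x \<partial>lborel)"
proof -
  have "(\<integral>\<^sup>+x. ball_avg \<rho> h x * k x \<partial>lborel)
      = (\<integral>\<^sup>+x. \<integral>\<^sup>+y. ball_kernel \<rho> x y * h y * k x \<partial>lborel \<partial>lborel)"
    unfolding ball_avg_def by (simp add: nn_integral_multc)
  also have "\<dots> = (\<integral>\<^sup>+y. \<integral>\<^sup>+x. ball_kernel \<rho> x y * h y * k x \<partial>lborel \<partial>lborel)"
    by (rule lborel_pair.Fubini') measurable
  also have "\<dots> = (\<integral>\<^sup>+y. \<integral>\<^sup>+x. h y * (ball_kernel \<rho> y x * k x) \<partial>lborel \<partial>lborel)"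
    by (simp add: ball_kernel_sym ac_simps)
  also have "\<dots> = (\<integral>\<^sup>+x. h x * ball_avg \<rho> k x \<partial>lborel)"
    unfolding ball_avg_def by (simp add: nn_integral_cmult)
  finally show ?thesis .
qed

lemma nn_integral_ball_avg_le:
  fixes h :: "'a::euclidean_space \<Rightarrow> ennreal"
  assumes [measurable]: "h \<in> borel_measurable borel"
  shows "(\<integral>\<^sup>+x. ball_avg \<rho> h x \<partial>lborel) \<le> (\<integral>\<^sup>+x. h x \<partial>lborel)"
proof -
  have "(\<integral>\<^sup>+x. ball_avg \<rho> h x \<partial>lborel) = (\<integral>\<^sup>+x. h x * ball_avg \<rho> (\<lambda>_. 1) x \<partial>lborel)"
    using nn_integral_ball_avg[of h "\<lambda>_. 1"] by simp
  also have "\<dots> \<le> (\<integral>\<^sup>+x. h x * 1 \<partial>lborel)"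
    by (intro nn_integral_mono mult_left_mono ball_avg_const_le) auto
  finally show ?thesis by simp
qed

text \<open>The kernels compare pointwise, with the ratio of the two ball volumes as factor.\<close>

lemma ball_avg_subset_le:
  fixes h :: "'a::euclidean_space \<Rightarrow> ennreal"
  assumes [measurable]: "h \<in> borel_measurable borel" and "0 < \<rho>" "0 < \<sigma>" "ball z \<rho> \<subseteq> ball x \<sigma>"
  shows "ball_avg \<rho> h z \<le> ennreal ((\<sigma> / \<rho>) ^ DIM('a)) * ball_avg \<sigma> h x"
proof -
  have "ball_kernel \<rho> z y \<le> ennreal ((\<sigma> / \<rho>) ^ DIM('a)) * ball_kernel \<sigma> x y" for y
  proof -
    have pos: "0 < unit_ball_vol (real DIM('a))" by simp
    have "inverse (emeasure lborel (ball (0::'a) \<rho>))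
       = ennreal ((\<sigma> / \<rho>) ^ DIM('a)) * inverse (emeasure lborel (ball (0::'a) \<sigma>))"
      using assms pos unfolding emeasure_ball_max
      by (simp add: inverse_ennreal ennreal_mult[symmetric] power_divide field_simps)
    then show ?thesis
      using assms by (auto simp: ball_kernel_def indicator_def)
  qed
  then have "ball_avg \<rho> h z \<le> (\<integral>\<^sup>+y. ennreal ((\<sigma> / \<rho>) ^ DIM('a)) * ball_kernel \<sigma> x y * h y \<partial>lborel)"
    unfolding ball_avg_def by (intro nn_integral_mono mult_right_mono) auto
  also have "\<dots> = (\<integral>\<^sup>+y. ennreal ((\<sigma> / \<rho>) ^ DIM('a)) * (ball_kernel \<sigma> x y * h y) \<partial>lborel)"
    by (simp only: ac_simps)
  also have "\<dots> = ennreal ((\<sigma> / \<rho>) ^ DIM('a)) * ball_avg \<sigma> h x"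
    unfolding ball_avg_def by (rule nn_integral_cmult) measurable
  finally show ?thesis .
qed

lemma le_ball_avg:
  fixes h :: "'a::euclidean_space \<Rightarrow> ennreal"
  assumes "0 < \<rho>" "\<And>w. w \<in> ball z \<rho> \<Longrightarrow> e \<le> h w"
  shows "e \<le> ball_avg \<rho> h z"
proof -
  have "e = (\<integral>\<^sup>+y. ball_kernel \<rho> z y * e \<partial>lborel)"
    using assms(1) by (simp add: nn_integral_multc nn_integral_ball_kernel_eq_1)
  also have "\<dots> \<le> ball_avg \<rho> h z"
    unfolding ball_avg_def
    by (intro nn_integral_mono) (auto simp: ball_kernel_def indicator_def intro!: mult_left_mono assms(2))
  finally show ?thesis .
qed

text \<open>A rational radius between \<open>\<rho>\<close> and \<open>2 * \<rho>\<close> enlarges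
  the volume by less than 2^d.\<close>

lemma ball_avg_le_max_fun:
  fixes h :: "'a::euclidean_space \<Rightarrow> ennreal"
  assumes [measurable]: "h \<in> borel_measurable borel"
  shows "ball_avg \<rho> h x \<le> 2 ^ DIM('a) * max_fun h x"
proof (cases "0 < \<rho>")
  case True
  then obtain \<sigma> where \<sigma>: "\<sigma> \<in> \<rat>" "\<rho> < \<sigma>" "\<sigma> < 2 * \<rho>"
    using Rats_dense_in_real[of \<rho> "2 * \<rho>"] by auto
  have "ball_avg \<rho> h x \<le> ennreal ((\<sigma> / \<rho>) ^ DIM('a)) * ball_avg \<sigma> h x"
    using True \<sigma> by (intro ball_avg_subset_le subset_ball) auto
  also have "\<dots> \<le> ennreal (2 ^ DIM('a)) * max_fun h x"
    using True \<sigma> unfolding max_fun_def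
    by (intro mult_mono ennreal_leI power_mono SUP_upper) (auto simp: field_simps)
  finally show ?thesis by (simp add: ennreal_power[symmetric])
next
  case False
  then show ?thesis by (simp add: ball_avg_def ball_kernel_def ball_empty)
qed

text \<open>Vitali's argument: each point of the superlevel set is the centre of a ball whose volume
  is at most 1/a times the integral of \<open>h\<close> over it. A disjoint subfamily whose fivefold
  enlargements still cover the set gives 5^d / a.\<close>

lemma max_fun_weak_type:
  fixes h :: "'a::euclidean_space \<Rightarrow> ennreal"
  assumes [measurable]: "h \<in> borel_measurable borel" and a: "0 < a"
  shows "emeasure lborel {x. ennreal a < max_fun h x}
      \<le> ennreal (5 ^ DIM('a) / a) * (\<integral>\<^sup>+x. h x \<partial>lborel)"
proof (cases "(\<integral>\<^sup>+x. h x \<partial>lborel) = top")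
  case True
  then show ?thesis using a by (simp add: ennreal_mult_top)
next
  case False
  define K where "K = {x. ennreal a < max_fun h x}"
  let ?D = "DIM('a)" and ?c = "unit_ball_vol (real DIM('a))"
  obtain I where I: "0 \<le> I" "(\<integral>\<^sup>+x. h x \<partial>lborel) = ennreal I"
    using False by (cases "\<integral>\<^sup>+x. h x \<partial>lborel") auto
  have "\<exists>\<rho>>0. ennreal a < ball_avg \<rho> h x" if "x \<in> K" for x
    using that by (auto simp: K_def max_fun_def less_SUP_iff)
  then obtain r where r: "\<And>x. x \<in> K \<Longrightarrow> 0 < r x" "\<And>x. x \<in> K \<Longrightarrow> ennreal a < ball_avg (r x) h x"
    by metis
  have cancel: "ennreal (V / a) * inverse (ennreal V) = ennreal (1 / a)" if "0 < V" for V
    using that a by (simp add: inverse_ennreal ennreal_mult[symmetric] field_simps)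
  have vol: "emeasure lborel (ball x (r x)) \<le> ennreal (1 / a) * (\<integral>\<^sup>+y\<in>ball x (r x). h y \<partial>lborel)"
    if "x \<in> K" for x
  proof -
    let ?I = "\<integral>\<^sup>+y\<in>ball x (r x). h y \<partial>lborel"
    have v: "emeasure lborel (ball x (r x)) = ennreal (?c * r x ^ ?D)" "0 < ?c * r x ^ ?D"
      using r(1)[OF that] by (auto simp: emeasure_ball)
    have "ennreal a \<le> inverse (emeasure lborel (ball x (r x))) * ?I"
      using r(2)[OF that] by (simp add: ball_avg_altdef less_imp_le)
    then have "ennreal (?c * r x ^ ?D / a) * ennreal a
       \<le> ennreal (?c * r x ^ ?D / a) * (inverse (ennreal (?c * r x ^ ?D)) * ?I)"
      unfolding v by (intro mult_left_mono) auto
    also have "\<dots> = ennreal (?c * r x ^ ?D / a) * inverse (ennreal (?c * r x ^ ?D)) * ?I"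
      by (simp only: mult.assoc)
    also have "ennreal (?c * r x ^ ?D / a) * inverse (ennreal (?c * r x ^ ?D)) = ennreal (1 / a)"
      by (rule cancel) (rule v(2))
    finally show ?thesis
      using v(2) a unfolding v(1) by (simp add: ennreal_mult[symmetric])
  qed
  \<comment> \<open>The covering lemma asks for bounded radii. If a radius r exceeds 1, then r <=
    r^d, and the volume of its ball is at most I / a; this is where finiteness of the integral
    enters.\<close>
  define B where "B = max 1 (I / (a * ?c))"
  have "r x \<le> B" if "x \<in> K" for x
  proof (cases "r x \<le> 1")
    case False
    have "ennreal (?c * r x ^ ?D) \<le> ennreal (1 / a) * (\<integral>\<^sup>+y\<in>ball x (r x). h y \<partial>lborel)"
      using vol[OF that] r(1)[OF that] by (simp add: emeasure_ball)
    also have "\<dots> \<le> ennreal (1 / a) * ennreal I"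
      unfolding I(2)[symmetric] by (intro mult_left_mono nn_integral_mono) (auto simp: indicator_def)
    also have "\<dots> = ennreal (I / a)"
      using a I by (simp add: ennreal_mult[symmetric])
    finally have "?c * r x ^ ?D \<le> I / a"
      using a I by simp
    moreover have "?c * r x \<le> ?c * r x ^ ?D"
      using False by (intro mult_left_mono self_le_power) auto
    ultimately have "?c * r x \<le> I / a" by linarith
    then have "r x \<le> I / (a * ?c)"
      using a by (simp add: field_simps)
    then show ?thesis by (simp add: B_def)
  qed (simp add: B_def)
  then have rB: "0 < r x \<and> r x \<le> B" if "x \<in> K" for x
    using r(1) that by blast
  obtain C where C: "countable C" "C \<subseteq> K"
     "pairwise (\<lambda>i j. disjnt (cball i (r i)) (cball j (r j))) C"
     "\<And>i. i \<in> K \<Longrightarrow> \<exists>j. j \<in> C \<and> \<not> disjnt (cball i (r i)) (cball j (r j)) \<and>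
                        cball i (r i) \<subseteq> ball j (5 * r j)"
    by (rule Vitali_covering_lemma_cballs_balls[of K r B "\<lambda>x. x", OF rB], assumption) (rule that; assumption)
  \<comment> \<open>Summing over \<open>C\<close> as an integral for \<open>count_space\<close>
    turns countable subadditivity into an interchange of integrals.\<close>
  have "emeasure lborel K = (\<integral>\<^sup>+x. indicator K x \<partial>lborel)"
    by (simp add: K_def)
  also have "\<dots> \<le> (\<integral>\<^sup>+x. \<integral>\<^sup>+j. indicator (ball j (5 * r j)) x \<partial>count_space C \<partial>lborel)"
  proof (intro nn_integral_mono)
    fix x
    show "indicator K x \<le> (\<integral>\<^sup>+j. indicator (ball j (5 * r j)) x \<partial>count_space C :: ennreal)"
    proof (cases "x \<in> K")
      case True
      then obtain j where j: "j \<in> C" "x \<in> ball j (5 * r j)"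
        using C(4)[OF True] r(1)[OF True] by (meson centre_in_cball less_imp_le subsetD)
      have "(1::ennreal) = indicator (ball j (5 * r j)) x" using j by simp
      also have "\<dots> \<le> (\<integral>\<^sup>+j. indicator (ball j (5 * r j)) x \<partial>count_space C)"
        by (rule nn_integral_ge_point[OF j(1)])
      finally show ?thesis using True by simp
    qed simp
  qed
  also have "\<dots> = (\<integral>\<^sup>+j. \<integral>\<^sup>+x. indicator (ball j (5 * r j)) x \<partial>lborel \<partial>count_space C)"
    using C(1) by (intro nn_integral_count_space_nn_integral) (auto intro!: borel_measurable_indicator)
  also have "\<dots> = (\<integral>\<^sup>+j. emeasure lborel (ball j (5 * r j)) \<partial>count_space C)"
    by simp
  also have "\<dots> \<le> (\<integral>\<^sup>+j. ennreal (5 ^ ?D / a) * (\<integral>\<^sup>+y\<in>ball j (r j). h y \<partial>lborel) \<partial>count_space C)"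
  proof (intro nn_integral_mono)
    fix j assume "j \<in> space (count_space C)"
    then have j: "j \<in> K" using C(2) by auto
    have "emeasure lborel (ball j (5 * r j)) = ennreal (5 ^ ?D) * emeasure lborel (ball j (r j))"
      using r(1)[OF j] by (simp add: emeasure_ball ennreal_mult[symmetric] power_mult_distrib ac_simps
         del: ennreal_power ennreal_numeral)
    also have "\<dots> \<le> ennreal (5 ^ ?D) * (ennreal (1 / a) * (\<integral>\<^sup>+y\<in>ball j (r j). h y \<partial>lborel))"
      by (intro mult_left_mono vol j) auto
    also have "\<dots> = ennreal (5 ^ ?D / a) * (\<integral>\<^sup>+y\<in>ball j (r j). h y \<partial>lborel)"
      using a by (simp add: mult.assoc[symmetric] ennreal_mult[symmetric])
    finally show "emeasure lborel (ball j (5 * r j))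
        \<le> ennreal (5 ^ ?D / a) * (\<integral>\<^sup>+y\<in>ball j (r j). h y \<partial>lborel)" .
  qed
  \<comment> \<open>With \<open>h\<close> as a density, the sum over the disjoint balls is the
    measure of their union.\<close>
  also have "\<dots> = ennreal (5 ^ ?D / a) * (\<integral>\<^sup>+j. emeasure (density lborel h) (ball j (r j)) \<partial>count_space C)"
    by (simp add: nn_integral_cmult emeasure_density)
  also have "(\<integral>\<^sup>+j. emeasure (density lborel h) (ball j (r j)) \<partial>count_space C)
      = emeasure (density lborel h) (\<Union>j\<in>C. ball j (r j))"
  proof (rule emeasure_UN_countable[symmetric])
    show "disjoint_family_on (\<lambda>j. ball j (r j)) C"
      unfolding disjoint_family_on_def
    proof (intro ballI impI)
      fix i j assume "i \<in> C" "j \<in> C" "i \<noteq> j"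
      then have "disjnt (cball i (r i)) (cball j (r j))" using C(3) by (simp add: pairwise_def)
      then show "ball i (r i) \<inter> ball j (r j) = {}"
        using ball_subset_cball[of i "r i"] ball_subset_cball[of j "r j"]
            unfolding disjnt_def by blast
    qed
  qed (use C in auto)
  also have "\<dots> \<le> (\<integral>\<^sup>+x. h x \<partial>lborel)"
    using C(1) by (subst emeasure_density) (auto intro!: nn_integral_mono simp: indicator_def)
  finally show ?thesis
    unfolding K_def by (simp add: mult_left_mono)
qed

text \<open>For finite \<open>x\<close> this is the integral of a power from 0 to \<open>x\<close>.
  For infinite \<open>x\<close> the right-hand side dominates its value at n^(1/P), which is n, for
  every n.\<close>

lemma ennreal_powr_layer_cake:
  assumes P: "0 < P"
  shows "ennreal_powr x P = (\<integral>\<^sup>+a. ennreal (P * a powr (P - 1))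
      * indicator {a. 0 < a \<and> ennreal a < x} a \<partial>lborel)"
proof -
  have fin: "ennreal (w powr P) = (\<integral>\<^sup>+a. ennreal (P * a powr (P - 1))
      * indicator {a. 0 < a \<and> ennreal a < ennreal w} a \<partial>lborel)"
    if w: "0 \<le> w" for w
  proof -
    have "((\<lambda>a. a powr (P - 1)) has_integral (w powr P / P)) {0..w}"
      using has_integral_powr_from_0[of "P - 1" w] P w by simp
    then have "((\<lambda>a. P * a powr (P - 1)) has_integral (P * (w powr P / P))) {0..w}"
      by (rule has_integral_mult_right)
    then have "((\<lambda>a. P * a powr (P - 1)) has_integral (w powr P)) {0..w}"
      using P by simp
    then have "((\<lambda>a. if a \<in> {0..w} then P * a powr (P - 1) else 0) has_integral (w powr P)) UNIV"
      by (simp only: has_integral_restrict_UNIV)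
    then have "(\<integral>\<^sup>+a. ennreal (if a \<in> {0..w} then P * a powr (P - 1) else 0) \<partial>lborel)
        = ennreal (w powr P)"
      using P by (intro nn_integral_has_integral_lborel) auto
    \<comment> \<open>The closed interval and the strict inequalities of the indicator differ only
      at the two endpoints.\<close>
    moreover have "AE a in lborel. a \<noteq> (0::real) \<and> a \<noteq> w"
      using AE_lborel_singleton[of "0::real"] AE_lborel_singleton[of w] by eventually_elim auto
    then have "(\<integral>\<^sup>+a. ennreal (if a \<in> {0..w} then P * a powr (P - 1) else 0) \<partial>lborel)
        = (\<integral>\<^sup>+a. ennreal (P * a powr (P - 1))
            * indicator {a. 0 < a \<and> ennreal a < ennreal w} a \<partial>lborel)"
      by (intro nn_integral_cong_AE, elim eventually_mono) (auto simp: indicator_def ennreal_less_iff)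
    ultimately show ?thesis by simp
  qed
  show ?thesis
  proof (cases x)
    case (real w)
    then show ?thesis using fin[of w] by (simp add: ennreal_powr_ennreal)
  next
    case top
    have "of_nat n \<le> (\<integral>\<^sup>+a. ennreal (P * a powr (P - 1))
        * indicator {a. 0 < a \<and> ennreal a < x} a \<partial>lborel)" for n :: nat
    proof -
      have "of_nat n = ennreal ((real n powr (1/P)) powr P)"
        using P by (simp add: powr_powr ennreal_of_nat_eq_real_of_nat)
      also have "\<dots> \<le> (\<integral>\<^sup>+a. ennreal (P * a powr (P - 1))
          * indicator {a. 0 < a \<and> ennreal a < x} a \<partial>lborel)"
        by (subst fin) (auto intro!: nn_integral_mono mult_left_mono simp: indicator_def top)
      finally show ?thesis .
    qed
    then have "(\<integral>\<^sup>+a. ennreal (P * a powr (P - 1))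
        * indicator {a. 0 < a \<and> ennreal a < x} a \<partial>lborel) = top"
      by (metis ennreal_Ex_less_of_nat linorder_not_less top.not_eq_extremum)
    then show ?thesis using top by simp
  qed
qed

text \<open>Marcinkiewicz interpolation by hand between weak type (1,1) and the trivial L^infinity
  bound. Halving the level accounts for 2^P, the weak type bound for 5^d, and integrating a^(P-2)
  for the denominator P - 1.\<close>

lemma max_fun_strong_type:
  fixes h :: "'a::euclidean_space \<Rightarrow> ennreal"
  assumes [measurable]: "h \<in> borel_measurable borel" and P: "1 < P"
  shows "(\<integral>\<^sup>+x. ennreal_powr (max_fun h x) P \<partial>lborel)
    \<le> ennreal (2 powr P * 5 ^ DIM('a) * P / (P - 1)) * (\<integral>\<^sup>+x. ennreal_powr (h x) P \<partial>lborel)"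
proof -
  define c where "c = (5::real) ^ DIM('a)"
  have c: "0 < c" by (simp add: c_def)
  have weak: "emeasure lborel {x. ennreal a < max_fun h x}
     \<le> (\<integral>\<^sup>+x. ennreal (2 * c / a) * (h x * indicator {x. ennreal a < 2
         * h x} x) \<partial>lborel)" if a: "0 < a" for a
  proof -
    \<comment> \<open>The discarded part of \<open>h\<close> is at most a/2 and adds at most a/2 to
      any average, so \<open>max_fun k\<close> exceeds a/2 wherever \<open>max_fun h\<close> exceeds
      a.\<close>
    define k where "k x = h x * indicator {x. ennreal a < 2 * h x} x" for x
    have [measurable]: "k \<in> borel_measurable borel" unfolding k_def by measurable
    have "h y \<le> k y + ennreal (a / 2)" for y
    proof (cases "ennreal a < 2 * h y")
      case False
      then have "2 * h y \<le> 2 * ennreal (a / 2)"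
        using a by (simp add: not_less ennreal_mult[symmetric] flip: ennreal_numeral)
      then show ?thesis using False
        by (simp add: k_def ennreal_mult_le_mult_iff)
    qed (simp add: k_def)
    then have avg_le: "ball_avg \<rho> h x \<le> ball_avg \<rho> k x + ennreal (a / 2)" for \<rho> x
      by (intro order_trans[OF ball_avg_mono[of h "\<lambda>y. k y + ennreal (a / 2)"]])
         (auto simp: ball_avg_add intro!: add_left_mono ball_avg_const_le)
    have max_le: "max_fun h x \<le> max_fun k x + ennreal (a / 2)" for x
      unfolding max_fun_def
      by (intro SUP_least order_trans[OF avg_le] add_right_mono SUP_upper)
    have "ennreal (a / 2) < max_fun k x" if "ennreal a < max_fun h x" for x
    proof (rule ccontr)
      assume "\<not> ?thesis"
      then have "max_fun k x + ennreal (a / 2) \<le> ennreal (a / 2) + ennreal (a / 2)"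
        by (intro add_right_mono) auto
      also have "\<dots> = ennreal a" using a by (simp flip: ennreal_plus)
      finally show False using max_le[of x] that by auto
    qed
    then have "emeasure lborel {x. ennreal a < max_fun h x}
        \<le> emeasure lborel {x. ennreal (a / 2) < max_fun k x}"
      by (intro emeasure_mono) auto
    also have "\<dots> \<le> ennreal (c / (a / 2)) * (\<integral>\<^sup>+x. k x \<partial>lborel)"
      unfolding c_def by (rule max_fun_weak_type) (use a in auto)
    also have "\<dots> = (\<integral>\<^sup>+x. ennreal (2 * c / a) * k x \<partial>lborel)"
      by (subst nn_integral_cmult) (auto simp: field_simps)
    finally show ?thesis by (simp add: k_def)
  qed
  have "(\<integral>\<^sup>+x. ennreal_powr (max_fun h x) P \<partial>lborel)
     = (\<integral>\<^sup>+x. \<integral>\<^sup>+a. ennreal (P * a powr (P - 1))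
         * indicator {a. 0 < a \<and> ennreal a < max_fun h x} a \<partial>lborel \<partial>lborel)"
    using P by (simp add: ennreal_powr_layer_cake)
  also have "\<dots> = (\<integral>\<^sup>+a. \<integral>\<^sup>+x. ennreal (P * a powr (P - 1))
      * indicator {a. 0 < a \<and> ennreal a < max_fun h x} a \<partial>lborel \<partial>lborel)"
    by (rule lborel_pair.Fubini') (simp add: indicator_def)
  \<comment> \<open>The weight is regrouped around \<open>(P - 1) * a powr (P - 2)\<close>: after
    the next interchange, the integral over \<open>a\<close> is the layer-cake formula for the power
    P - 1 of \<open>2 * h x\<close>.\<close>
  also have "\<dots> \<le> (\<integral>\<^sup>+a. \<integral>\<^sup>+x. ennreal (2 * c * P / (P - 1)) * (h x *
       (ennreal ((P - 1) * a powr (P - 1 - 1)) * indicator {a. 0 < a \<and> ennreal a < 2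
           * h x} a)) \<partial>lborel \<partial>lborel)"
  proof (rule nn_integral_mono)
    fix a :: real
    show "(\<integral>\<^sup>+x. ennreal (P * a powr (P - 1))
        * indicator {a. 0 < a \<and> ennreal a < max_fun h x} a \<partial>lborel)
      \<le> (\<integral>\<^sup>+x. ennreal (2 * c * P / (P - 1)) * (h x *
       (ennreal ((P - 1) * a powr (P - 1 - 1)) * indicator {a. 0 < a \<and> ennreal a < 2
           * h x} a)) \<partial>lborel)"
    proof (cases "0 < a")
      case True
      have "(\<integral>\<^sup>+x. ennreal (P * a powr (P - 1))
          * indicator {a. 0 < a \<and> ennreal a < max_fun h x} a \<partial>lborel)
        = (\<integral>\<^sup>+x. ennreal (P * a powr (P - 1)) * indicator {x. ennreal a < max_fun h x} x \<partial>lborel)"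
        using True by (simp add: indicator_def)
      also have "\<dots> = ennreal (P * a powr (P - 1)) * emeasure lborel {x. ennreal a < max_fun h x}"
        by (subst nn_integral_cmult_indicator) auto
      also have "\<dots> \<le> ennreal (P * a powr (P - 1)) *
         (\<integral>\<^sup>+x. ennreal (2 * c / a) * (h x * indicator {x. ennreal a < 2 * h x} x) \<partial>lborel)"
        by (intro mult_left_mono weak True) auto
      also have "\<dots> = (\<integral>\<^sup>+x. ennreal (P * a powr (P - 1)) * (ennreal (2 * c / a) * (h x
          * indicator {x. ennreal a < 2 * h x} x)) \<partial>lborel)"
        by (subst nn_integral_cmult[symmetric]) auto
      also have "\<dots> = (\<integral>\<^sup>+x. ennreal (2 * c * P / (P - 1)) * (h x *
       (ennreal ((P - 1) * a powr (P - 1 - 1)) * indicator {a. 0 < a \<and> ennreal a < 2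
           * h x} a)) \<partial>lborel)"
      proof (intro nn_integral_cong)
        fix x
        have "P * a powr (P - 1) * (2 * c / a)
            = 2 * c * P / (P - 1) * ((P - 1) * a powr (P - 1 - 1))"
          using True P by (simp add: powr_diff power2_eq_square)
        then have "ennreal (P * a powr (P - 1)) * ennreal (2 * c / a)
           = ennreal (2 * c * P / (P - 1)) * ennreal ((P - 1) * a powr (P - 1 - 1))"
          using P c True by (subst (1 2) ennreal_mult[symmetric]) auto
        then have "(ennreal (P * a powr (P - 1)) * ennreal (2 * c / a)) * (h x
            * indicator {x. ennreal a < 2 * h x} x)
          = (ennreal (2 * c * P / (P - 1)) * ennreal ((P - 1) * a powr (P - 1 - 1))) * (h x
              * indicator {x. ennreal a < 2 * h x} x)"
          by simp
        then show "ennreal (P * a powr (P - 1)) * (ennreal (2 * c / a) * (h x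
            * indicator {x. ennreal a < 2 * h x} x))
          = ennreal (2 * c * P / (P - 1)) * (h x *
            (ennreal ((P - 1) * a powr (P - 1 - 1)) * indicator {a. 0 < a \<and> ennreal a < 2
                * h x} a))"
          using True by (simp only: ac_simps indicator_def mem_Collect_eq simp_thms)
      qed
      finally show ?thesis .
    qed simp
  qed
  also have "\<dots> = (\<integral>\<^sup>+x. \<integral>\<^sup>+a. ennreal (2 * c * P / (P - 1)) * (h x *
       (ennreal ((P - 1) * a powr (P - 1 - 1)) * indicator {a. 0 < a \<and> ennreal a < 2
           * h x} a)) \<partial>lborel \<partial>lborel)"
    by (rule lborel_pair.Fubini') (simp add: indicator_def)
  also have "\<dots> = (\<integral>\<^sup>+x. ennreal (2 * c * P / (P - 1)) * (h x * ennreal_powr (2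
      * h x) (P - 1)) \<partial>lborel)"
    using P by (simp add: ennreal_powr_layer_cake nn_integral_cmult)
  also have "\<dots> = (\<integral>\<^sup>+x. ennreal (2 powr P * c * P / (P - 1)) * ennreal_powr (h x) P \<partial>lborel)"
  proof (intro nn_integral_cong)
    fix x
    have "h x * ennreal_powr (2 * h x) (P - 1)
        = ennreal (2 powr (P - 1)) * (ennreal_powr (h x) 1 * ennreal_powr (h x) (P - 1))"
      by (simp add: ennreal_powr_mult ac_simps ennreal_powr_ennreal flip: ennreal_numeral)
    also have "\<dots> = ennreal (2 powr (P - 1)) * ennreal_powr (h x) P"
      using P by (simp add: ennreal_powr_add[symmetric] del: ennreal_powr_1)
    finally have *: "h x * ennreal_powr (2 * h x) (P - 1)
        = ennreal (2 powr (P - 1)) * ennreal_powr (h x) P" .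
    have const: "2 * c * P / (P - 1) * 2 powr (P - 1) = 2 powr P * c * P / (P - 1)"
      using P by (simp add: powr_diff field_simps)
    show "ennreal (2 * c * P / (P - 1)) * (h x * ennreal_powr (2 * h x) (P - 1))
       = ennreal (2 powr P * c * P / (P - 1)) * ennreal_powr (h x) P"
      unfolding * const[symmetric] using P c by (subst ennreal_mult) (auto simp: mult.assoc)
  qed
  also have "\<dots> = ennreal (2 powr P * c * P / (P - 1)) * (\<integral>\<^sup>+x. ennreal_powr (h x) P \<partial>lborel)"
    by (rule nn_integral_cmult) measurable
  finally show ?thesis by (simp add: c_def)
qed


section \<open>Vector-valued averages\<close>

text \<open>Bound for the P-th power of 2^d \<open>max_fun\<close>, the common majorant of averages
  of all radii: the first factor is the P-th power of 2^d, the second is the constant of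
  \<open>max_fun_strong_type\<close>.\<close>

definition max_const :: "nat \<Rightarrow> real \<Rightarrow> real" where
  "max_const d P = 2 powr (real d * P) * (2 powr P * 5 ^ d * P / (P - 1))"

lemma max_const_pos: "1 < P \<Longrightarrow> 0 < max_const d P"
  by (simp add: max_const_def)

lemma nn_integral_max_fun_powr_le:
  fixes h :: "'a::euclidean_space \<Rightarrow> ennreal"
  assumes [measurable]: "h \<in> borel_measurable borel" and P: "1 < P"
  shows "(\<integral>\<^sup>+x. ennreal_powr (2 ^ DIM('a) * max_fun h x) P \<partial>lborel)
    \<le> ennreal (max_const DIM('a) P) * (\<integral>\<^sup>+x. ennreal_powr (h x) P \<partial>lborel)"
proof -
  have "ennreal_powr (2 ^ DIM('a)) P = ennreal_powr (ennreal (2 powr DIM('a))) P"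
    by (simp add: powr_realpow ennreal_power flip: ennreal_numeral)
  then have e: "ennreal_powr (2 ^ DIM('a)) P = ennreal (2 powr (real DIM('a) * P))"
    by (simp add: ennreal_powr_ennreal powr_powr)
  have "(\<integral>\<^sup>+x. ennreal_powr (2 ^ DIM('a) * max_fun h x) P \<partial>lborel)
    = ennreal (2 powr (real DIM('a) * P)) * (\<integral>\<^sup>+x. ennreal_powr (max_fun h x) P \<partial>lborel)"
    unfolding ennreal_powr_mult e by (rule nn_integral_cmult) measurable
  also have "\<dots> \<le> ennreal (2 powr (real DIM('a) * P)) *
     (ennreal (2 powr P * 5 ^ DIM('a) * P / (P - 1)) * (\<integral>\<^sup>+x. ennreal_powr (h x) P \<partial>lborel))"
    by (intro mult_left_mono max_fun_strong_type assms) auto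
  also have "\<dots> = ennreal (max_const DIM('a) P) * (\<integral>\<^sup>+x. ennreal_powr (h x) P \<partial>lborel)"
    using P unfolding max_const_def by (subst ennreal_mult) (auto simp: mult.assoc)
  finally show ?thesis .
qed

text \<open>Cancels the power of \<open>X\<close> that reappears on the right at the end of a
  duality argument. The cancellation requires \<open>X\<close> to be finite, which is why that
  argument truncates.\<close>

lemma ennreal_absorb:
  assumes "X \<le> B * ennreal_powr X (1 - 1 / P)" "X \<noteq> top" "1 < P"
  shows "X \<le> ennreal_powr B P"
proof (cases "X = 0")
  case False
  have "ennreal_powr X (1 / P + (1 - 1 / P)) = ennreal_powr X (1 / P) * ennreal_powr X (1 - 1 / P)"
    using assms by (intro ennreal_powr_add) auto
  then have "ennreal_powr X (1 - 1 / P) * ennreal_powr X (1 / P) \<le> ennreal_powr X (1 - 1 / P) * B"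
    using assms by (simp add: ac_simps)
  then have "ennreal_powr X (1 / P) \<le> B"
    using False assms(2) by (subst (asm) ennreal_mult_le_mult_iff) auto
  then show ?thesis using assms by (simp add: ennreal_powr_le_iff)
qed simp

context
  fixes \<nu> :: "'t measure" and \<rho> :: "'t \<Rightarrow> real" and G :: "'t \<Rightarrow> 'a::euclidean_space \<Rightarrow> ennreal"
  assumes sf: "sigma_finite_measure \<nu>"
    and \<rho> [measurable]: "\<rho> \<in> borel_measurable \<nu>"
    and G [measurable]: "(\<lambda>(t, y). G t y) \<in> borel_measurable (\<nu> \<Otimes>\<^sub>M lborel)"
begin

interpretation sigma_finite_measure \<nu> by (rule sf)
interpretation pair_sigma_finite \<nu> "lborel :: 'a measure" ..

lemma borel_measurable_ball_avg_family:
  "(\<lambda>(t, x). ball_avg (\<rho> t) (G t) x) \<in> borel_measurable (\<nu> \<Otimes>\<^sub>M lborel)"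
  "(\<lambda>(x, t). ball_avg (\<rho> t) (G t) x) \<in> borel_measurable (lborel \<Otimes>\<^sub>M \<nu>)"
  unfolding case_prod_beta by (rule borel_measurable_ball_avg; measurable)+

lemma borel_measurable_family_snd:
  "t \<in> space \<nu> \<Longrightarrow> G t \<in> borel_measurable borel"
  using measurable_Pair2[OF G] by simp

text \<open>By Tonelli this is the L^1 contraction for each fixed \<open>t\<close>. Applied to Q-th
  powers after Jensen it settles P = Q.\<close>

lemma nn_integral_ball_avg_family_le:
  "(\<integral>\<^sup>+x. \<integral>\<^sup>+t. ball_avg (\<rho> t) (G t) x \<partial>\<nu> \<partial>lborel) \<le> (\<integral>\<^sup>+x. \<integral>\<^sup>+t. G t x \<partial>\<nu> \<partial>lborel)"
proof -
  note [measurable] = borel_measurable_ball_avg_family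
  have "(\<integral>\<^sup>+x. \<integral>\<^sup>+t. ball_avg (\<rho> t) (G t) x \<partial>\<nu> \<partial>lborel)
      = (\<integral>\<^sup>+t. \<integral>\<^sup>+x. ball_avg (\<rho> t) (G t) x \<partial>lborel \<partial>\<nu>)"
    by (rule Fubini') measurable
  also have "\<dots> \<le> (\<integral>\<^sup>+t. \<integral>\<^sup>+x. G t x \<partial>lborel \<partial>\<nu>)"
    by (rule nn_integral_mono) (intro nn_integral_ball_avg_le borel_measurable_family_snd)
  also have "\<dots> = (\<integral>\<^sup>+x. \<integral>\<^sup>+t. G t x \<partial>\<nu> \<partial>lborel)"
    by (rule Fubini'[symmetric]) measurable
  finally show ?thesis .
qed

text \<open>Averages are self-adjoint, so they can be moved onto a dual function, where the maximal
  function dominates them uniformly in the radius.\<close>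

lemma nn_integral_ball_avg_family_powr_le:
  assumes P: "1 < P"
  shows "(\<integral>\<^sup>+x. ennreal_powr (\<integral>\<^sup>+t. ball_avg (\<rho> t) (G t) x \<partial>\<nu>) P \<partial>lborel)
    \<le> ennreal (max_const DIM('a) (P / (P - 1)) powr (P - 1)) *
       (\<integral>\<^sup>+x. ennreal_powr (\<integral>\<^sup>+t. G t x \<partial>\<nu>) P \<partial>lborel)"
proof -
  note [measurable] = borel_measurable_ball_avg_family borel_measurable_family_snd
  define P' where "P' = P / (P - 1)"
  have P': "1 < P'" "1 - 1 / P = 1 / P'" "(P - 1) * P' = P"
    using P by (auto simp: P'_def field_simps)
  define E where "E = max_const DIM('a) P'"
  have E: "0 < E" using P' by (simp add: E_def max_const_pos)
  define F where "F x = (\<integral>\<^sup>+t. ball_avg (\<rho> t) (G t) x \<partial>\<nu>)" for x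
  define S where "S x = (\<integral>\<^sup>+t. G t x \<partial>\<nu>)" for x
  have [measurable]: "F \<in> borel_measurable borel" "S \<in> borel_measurable borel"
    unfolding F_def S_def by measurable
  \<comment> \<open>Truncation in height and in space makes the integral of the P-th power finite,
    as \<open>ennreal_absorb\<close> demands; monotone convergence removes it at the end.\<close>
  define f where "f n x = min (F x) (of_nat n) * indicator (ball 0 (real n)) x" for n x
  have [measurable]: "f n \<in> borel_measurable borel" for n
    unfolding f_def by (intro borel_measurable_times_ennreal borel_measurable_indicator) auto
  have bound: "(\<integral>\<^sup>+x. ennreal_powr (f n x) P \<partial>lborel)
      \<le> ennreal (E powr (P - 1)) * (\<integral>\<^sup>+x. ennreal_powr (S x) P \<partial>lborel)" for n
  proof -
    define X where "X = (\<integral>\<^sup>+x. ennreal_powr (f n x) P \<partial>lborel)"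
    \<comment> \<open>The extremal function of L^P duality: both f u and the P'-th power of u equal
      f^P, so testing against this single \<open>u\<close> makes \<open>X\<close> reappear on the
      right.\<close>
    define u where "u x = ennreal_powr (f n x) (P - 1)" for x
    have [measurable]: "u \<in> borel_measurable borel" unfolding u_def by measurable
    have "X \<le> (\<integral>\<^sup>+x. ennreal_powr (of_nat n) P
        * indicator (ball 0 (real n)) x \<partial>(lborel :: 'a measure))"
      unfolding X_def using P by (intro nn_integral_mono) (auto simp: f_def indicator_def intro!: ennreal_powr_mono)
    also have "\<dots> = ennreal_powr (of_nat n) P * emeasure lborel (ball (0::'a) (real n))"
      by (rule nn_integral_cmult_indicator) auto
    also have "\<dots> < top"
      by (auto simp: ennreal_mult_eq_top_iff emeasure_ball less_top[symmetric])
    finally have fin: "X \<noteq> top" by simp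
    have "X \<le> (\<integral>\<^sup>+x. F x * u x \<partial>lborel)"
      unfolding X_def
    proof (rule nn_integral_mono)
      fix x
      have "ennreal_powr (f n x) P = f n x * u x"
        using ennreal_powr_add[of 1 "P - 1" "f n x"] P by (simp add: u_def)
      also have "\<dots> \<le> F x * u x"
        by (intro mult_right_mono) (auto simp: f_def indicator_def)
      finally show "ennreal_powr (f n x) P \<le> F x * u x" .
    qed
    also have "\<dots> = (\<integral>\<^sup>+x. \<integral>\<^sup>+t. ball_avg (\<rho> t) (G t) x * u x \<partial>\<nu> \<partial>lborel)"
      unfolding F_def by (intro nn_integral_cong nn_integral_multc[symmetric]) measurable
    also have "\<dots> = (\<integral>\<^sup>+t. \<integral>\<^sup>+x. ball_avg (\<rho> t) (G t) x * u x \<partial>lborel \<partial>\<nu>)"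
      by (rule Fubini') measurable
    also have "\<dots> = (\<integral>\<^sup>+t. \<integral>\<^sup>+x. G t x * ball_avg (\<rho> t) u x \<partial>lborel \<partial>\<nu>)"
      by (intro nn_integral_cong nn_integral_ball_avg borel_measurable_family_snd) auto
    also have "\<dots> \<le> (\<integral>\<^sup>+t. \<integral>\<^sup>+x. G t x * (2 ^ DIM('a) * max_fun u x) \<partial>lborel \<partial>\<nu>)"
      by (intro nn_integral_mono mult_left_mono ball_avg_le_max_fun) auto
    also have "\<dots> = (\<integral>\<^sup>+x. \<integral>\<^sup>+t. G t x * (2 ^ DIM('a) * max_fun u x) \<partial>\<nu> \<partial>lborel)"
      by (rule Fubini'[symmetric]) measurable
    also have "\<dots> = (\<integral>\<^sup>+x. S x * (2 ^ DIM('a) * max_fun u x) \<partial>lborel)"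
      unfolding S_def by (intro nn_integral_cong nn_integral_multc) measurable
    also have "\<dots> = (\<integral>\<^sup>+x. ennreal_powr (ennreal_powr (S x) P) (1 / P) *
        ennreal_powr (ennreal_powr (2 ^ DIM('a) * max_fun u x) P') (1 - 1 / P) \<partial>lborel)"
      using P P' by simp
    also have "\<dots> \<le> ennreal_powr (\<integral>\<^sup>+x. ennreal_powr (S x) P \<partial>lborel) (1 / P) *
        ennreal_powr (\<integral>\<^sup>+x. ennreal_powr (2 ^ DIM('a) * max_fun u x) P' \<partial>lborel) (1 - 1 / P)"
      using P by (intro nn_integral_Hoelder) auto
    also have "\<dots> \<le> ennreal_powr (\<integral>\<^sup>+x. ennreal_powr (S x) P \<partial>lborel) (1 / P) *
        ennreal_powr (ennreal E * X) (1 - 1 / P)"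
    proof (intro mult_left_mono ennreal_powr_mono)
      have "(\<integral>\<^sup>+x. ennreal_powr (2 ^ DIM('a) * max_fun u x) P' \<partial>lborel)
        \<le> ennreal E * (\<integral>\<^sup>+x. ennreal_powr (u x) P' \<partial>lborel)"
        unfolding E_def by (rule nn_integral_max_fun_powr_le) (use P' in auto)
      also have "(\<integral>\<^sup>+x. ennreal_powr (u x) P' \<partial>lborel) = X"
        using P' by (simp add: X_def u_def ennreal_powr_powr)
      finally show "(\<integral>\<^sup>+x. ennreal_powr (2 ^ DIM('a) * max_fun u x) P' \<partial>lborel) \<le> ennreal E * X" .
    qed (use P in auto)
    finally have "X \<le> ennreal_powr (\<integral>\<^sup>+x. ennreal_powr (S x) P \<partial>lborel) (1 / P) *
        ennreal_powr (ennreal E) (1 - 1 / P) * ennreal_powr X (1 - 1 / P)"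
      by (simp add: ennreal_powr_mult mult.assoc)
    from ennreal_absorb[OF this fin P]
    have "X \<le> ennreal_powr (\<integral>\<^sup>+x. ennreal_powr (S x) P \<partial>lborel) (1 / P * P) *
        ennreal_powr (ennreal E) ((1 - 1 / P) * P)"
      by (simp only: ennreal_powr_mult ennreal_powr_powr)
    moreover have "1 / P * P = 1" "(1 - 1 / P) * P = P - 1" using P by (auto simp: field_simps)
    ultimately show ?thesis using E by (simp add: X_def ennreal_powr_ennreal mult.commute)
  qed
  have SUP_f: "(SUP n. f n x) = F x" for x
  proof (rule antisym)
    show "(SUP n. f n x) \<le> F x" by (intro SUP_least) (auto simp: f_def indicator_def)
    obtain m :: nat where m: "norm x < real m" using reals_Archimedean2 by blast
    show "F x \<le> (SUP n. f n x)"
    proof (rule ccontr)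
      assume "\<not> ?thesis"
      then have less: "(SUP n. f n x) < F x" by simp
      then have "(SUP n. f n x) < top" by (rule less_le_trans) simp
      then obtain k :: nat where k: "(SUP n. f n x) < of_nat k"
        using ennreal_Ex_less_of_nat by blast
      have "min (F x) (of_nat (max m k)) = f (max m k) x"
        using m by (simp add: f_def)
      also have "\<dots> \<le> (SUP n. f n x)" by (rule SUP_upper) simp
      finally have "min (F x) (of_nat (max m k)) \<le> (SUP n. f n x)" .
      moreover have "(of_nat k :: ennreal) \<le> of_nat (max m k)" by (rule of_nat_mono) simp
      ultimately show False using less k by (meson leD min_le_iff_disj order_trans)
    qed
  qed
  have inc: "incseq (\<lambda>n x. ennreal_powr (f n x) P)"
  proof (intro incseq_SucI le_funI ennreal_powr_mono)
    fix n x
    have "(of_nat n :: ennreal) \<le> of_nat (Suc n)" by (rule of_nat_mono) simp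
    then show "f n x \<le> f (Suc n) x"
      by (auto simp: f_def indicator_def min_le_iff_disj)
  qed (use P in auto)
  have "(\<integral>\<^sup>+x. ennreal_powr (F x) P \<partial>lborel) = (\<integral>\<^sup>+x. (SUP n. ennreal_powr (f n x) P) \<partial>lborel)"
    using P by (simp add: SUP_f[symmetric] SUP_ennreal_powr)
  also have "\<dots> = (SUP n. \<integral>\<^sup>+x. ennreal_powr (f n x) P \<partial>lborel)"
    by (rule nn_integral_monotone_convergence_SUP[OF inc]) auto
  also have "\<dots> \<le> ennreal (E powr (P - 1)) * (\<integral>\<^sup>+x. ennreal_powr (S x) P \<partial>lborel)"
    by (intro SUP_least bound)
  finally show ?thesis by (simp add: F_def S_def E_def P'_def)
qed

text \<open>\<open>K\<close> and \<open>V\<close> below factor \<open>G\<close> as in complex interpolation between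
  the trivial exponent \<open>Q = P\<close> and \<open>Q = \<infinity>\<close>, where the maximal function suffices; Hoelder's
  inequality passes the factorisation through the averages.\<close>

lemma nn_integral_ball_avg_family_powr_powr_le:
  assumes P: "1 < P" and Q: "P < Q"
  shows "(\<integral>\<^sup>+x. ennreal_powr (\<integral>\<^sup>+t. ennreal_powr (ball_avg (\<rho> t) (G t) x) Q \<partial>\<nu>) (P / Q) \<partial>lborel)
    \<le> ennreal (max_const DIM('a) P powr (1 - P / Q)) *
       (\<integral>\<^sup>+x. ennreal_powr (\<integral>\<^sup>+t. ennreal_powr (G t x) Q \<partial>\<nu>) (P / Q) \<partial>lborel)"
proof -
  note [measurable] = borel_measurable_ball_avg_family borel_measurable_family_snd
  define V where "V x = (\<integral>\<^sup>+t. ennreal_powr (G t x) Q \<partial>\<nu>)" for x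
  have [measurable]: "V \<in> borel_measurable borel"
    unfolding V_def by measurable
  define T where "T = (\<integral>\<^sup>+x. ennreal_powr (V x) (P / Q) \<partial>lborel)"
  \<comment> \<open>The interpolation parameter: 1/Q = (1 - b)/P + b/infinity.\<close>
  define b where "b = 1 - P / Q"
  have b: "0 < b" "b < 1" "P / Q = 1 - b" "b * Q / b = Q" "1 / Q * P = 1 - b"
    using P Q by (auto simp: b_def field_simps)
  show ?thesis
  proof (cases "T = top")
    case True
    then show ?thesis
      using max_const_pos[OF P, of "DIM('a)"]
          by (simp add: V_def[symmetric] T_def[symmetric] ennreal_mult_top)
  next
    case False
    \<comment> \<open>Finiteness of \<open>V x\<close> allows its b-th power to be cancelled against
      the denominator of \<open>K\<close>.\<close>
    have V_fin: "AE x in lborel. V x \<noteq> top"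
    proof -
      have "AE x in lborel. ennreal_powr (V x) (P / Q) \<noteq> \<infinity>"
        using False by (intro nn_integral_PInf_AE) (auto simp: T_def)
      then show ?thesis by simp
    qed
    \<comment> \<open>Since (1 - b)/P = 1/Q, the product of K^((1-b)/P) and S^b with S = V^(1/Q) is
      G. The factor K^(1/P) belongs to the endpoint with both exponents P, while \<open>S\<close>
      does not depend on t and belongs to the endpoint infinity.\<close>
    define K where "K t x = ennreal_powr (G t x) Q / ennreal_powr (V x) b" for t x
    have [measurable]: "(\<lambda>(t, x). K t x) \<in> borel_measurable (\<nu> \<Otimes>\<^sub>M lborel)"
      unfolding K_def by measurable
    have [measurable]: "K t \<in> borel_measurable borel" if "t \<in> space \<nu>" for t
      unfolding K_def[abs_def] using that by measurable
    define S where "S x = ennreal_powr (V x) (1 / Q)" for x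
    have [measurable]: "S \<in> borel_measurable borel" unfolding S_def by measurable
    \<comment> \<open>Only an inequality, because the quotient is 0 where \<open>V x\<close> is
      infinite.\<close>
    have K_le: "(\<integral>\<^sup>+t. K t x \<partial>\<nu>) \<le> ennreal_powr (V x) (P / Q)" for x
    proof -
      have "(\<integral>\<^sup>+t. K t x \<partial>\<nu>) = V x / ennreal_powr (V x) b"
        unfolding K_def V_def by (rule nn_integral_divide) measurable
      also have "\<dots> \<le> ennreal_powr (V x) (1 - b)"
      proof (cases "V x = 0 \<or> V x = top")
        case False
        have "ennreal_powr (V x) (b + (1 - b)) = ennreal_powr (V x) b * ennreal_powr (V x) (1 - b)"
          using b by (intro ennreal_powr_add) auto
        then have "V x / ennreal_powr (V x) b
            = ennreal_powr (V x) (1 - b) * ennreal_powr (V x) b / ennreal_powr (V x) b"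
          by (simp add: mult.commute)
        also have "\<dots> = ennreal_powr (V x) (1 - b)"
          using False by (intro ennreal_mult_divide_eq) auto
        finally show ?thesis by simp
      qed auto
      finally show ?thesis using b by simp
    qed
    have G_le: "AE x in lborel. AE t in \<nu>. G t x
        \<le> ennreal_powr (ennreal_powr (K t x) (1 / P)) (1 - b) * ennreal_powr (S x) b"
      using V_fin
    proof eventually_elim
      case (elim x)
      show ?case
      proof (cases "V x = 0")
        case True
        then have "AE t in \<nu>. ennreal_powr (G t x) Q = 0"
          unfolding V_def by (subst (asm) nn_integral_0_iff_AE) measurable
        then show ?thesis by eventually_elim simp
      next
        case False
        have "G t x \<le> ennreal_powr (ennreal_powr (K t x) (1 / P)) (1 - b)
            * ennreal_powr (S x) b" for t
        proof -
          have "K t x * ennreal_powr (V x) b = ennreal_powr (G t x) Q"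
            unfolding K_def using False elim by (simp add: ennreal_divide_times ennreal_divide_self less_top[symmetric])
          then have "ennreal_powr (K t x * ennreal_powr (V x) b) (1 / Q) = G t x"
            using P Q by simp
          then show ?thesis
            using P Q by (simp add: S_def ennreal_powr_mult ennreal_powr_powr mult.commute flip: b(3))
        qed
        then show ?thesis by simp
      qed
    qed
    \<comment> \<open>Averaging in space happens at a fixed \<open>t\<close>, so the exceptional
      null sets must first be rearranged to lie in space for almost every \<open>t\<close>.\<close>
    have "AE t in \<nu>. AE x in lborel. G t x \<le> ennreal_powr (ennreal_powr (K t x) (1 / P)) (1 - b)
        * ennreal_powr (S x) b"
      by (subst AE_commute) (use G_le in \<open>measurable\<close>)
    then have avg_le: "AE t in \<nu>. t \<in> space \<nu> \<longrightarrow> (\<forall>x. ennreal_powr (ball_avg (\<rho> t) (G t) x) Q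
      \<le> ball_avg (\<rho> t) (K t) x * ennreal_powr (2 ^ DIM('a) * max_fun S x) (b * Q))"
    proof eventually_elim
      case (elim t)
      show ?case
      proof (intro impI allI)
        fix x assume [measurable]: "t \<in> space \<nu>"
        have "ball_avg (\<rho> t) (G t) x
           \<le> ball_avg (\<rho> t) (\<lambda>y. ennreal_powr (ennreal_powr (K t y) (1 / P)) (1 - b)
               * ennreal_powr (S y) (1 - (1 - b))) x"
          using elim by (intro ball_avg_mono_AE) simp
        \<comment> \<open>Hoelder inside the ball separates the factors. The one with
          \<open>S\<close> goes to the maximal function; the other is raised to (1 - b) Q = P, where
          Jensen brings back \<open>K\<close> itself.\<close>
        also have "\<dots> \<le> ennreal_powr (ball_avg (\<rho> t) (\<lambda>y. ennreal_powr (K t y) (1 / P)) x) (1 - b)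
           * ennreal_powr (ball_avg (\<rho> t) S x) (1 - (1 - b))"
          using b by (intro ball_avg_Hoelder) auto
        also have "\<dots> \<le> ennreal_powr (ball_avg (\<rho> t) (\<lambda>y. ennreal_powr (K t y) (1 / P)) x) (1 - b)
           * ennreal_powr (2 ^ DIM('a) * max_fun S x) b"
          using b by (simp, intro mult_left_mono ennreal_powr_mono ball_avg_le_max_fun) auto
        finally have "ennreal_powr (ball_avg (\<rho> t) (G t) x) Q
          \<le> ennreal_powr (ennreal_powr (ball_avg (\<rho> t) (\<lambda>y. ennreal_powr (K t y) (1 / P)) x) (1 - b)
           * ennreal_powr (2 ^ DIM('a) * max_fun S x) b) Q"
          using P Q by (intro ennreal_powr_mono) auto
        also have "\<dots> = ennreal_powr (ball_avg (\<rho> t) (\<lambda>y. ennreal_powr (K t y) (1 / P)) x) P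
           * ennreal_powr (2 ^ DIM('a) * max_fun S x) (b * Q)"
        proof -
          have "(1 - b) * Q = P" using P Q by (simp add: b_def)
          then show ?thesis by (simp add: ennreal_powr_mult ennreal_powr_powr)
        qed
        also have "\<dots> \<le> ball_avg (\<rho> t) (\<lambda>y. ennreal_powr (ennreal_powr (K t y) (1 / P)) P) x
           * ennreal_powr (2 ^ DIM('a) * max_fun S x) (b * Q)"
          using P by (intro mult_right_mono ball_avg_Jensen) auto
        finally show "ennreal_powr (ball_avg (\<rho> t) (G t) x) Q
          \<le> ball_avg (\<rho> t) (K t) x * ennreal_powr (2 ^ DIM('a) * max_fun S x) (b * Q)"
          using P by simp
      qed
    qed
    \<comment> \<open>Averages contract L^1 for each \<open>t\<close>, so \<open>L\<close> inherits
      the bound \<open>T\<close> on the double integral of \<open>K\<close>.\<close>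
    define L where "L x = (\<integral>\<^sup>+t. ball_avg (\<rho> t) (K t) x \<partial>\<nu>)" for x
    have K_avg [measurable]: "(\<lambda>(t, x). ball_avg (\<rho> t) (K t) x) \<in> borel_measurable (\<nu> \<Otimes>\<^sub>M lborel)"
      "(\<lambda>(x, t). ball_avg (\<rho> t) (K t) x) \<in> borel_measurable (lborel \<Otimes>\<^sub>M \<nu>)"
      unfolding case_prod_beta by (rule borel_measurable_ball_avg; measurable)+
    have [measurable]: "L \<in> borel_measurable borel" unfolding L_def by measurable
    have L_le: "(\<integral>\<^sup>+x. L x \<partial>lborel) \<le> T"
    proof -
      have "(\<integral>\<^sup>+x. L x \<partial>lborel) = (\<integral>\<^sup>+t. \<integral>\<^sup>+x. ball_avg (\<rho> t) (K t) x \<partial>lborel \<partial>\<nu>)"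
        unfolding L_def by (rule Fubini') measurable
      also have "\<dots> \<le> (\<integral>\<^sup>+t. \<integral>\<^sup>+x. K t x \<partial>lborel \<partial>\<nu>)"
        by (rule nn_integral_mono) (simp add: nn_integral_ball_avg_le)
      also have "\<dots> = (\<integral>\<^sup>+x. \<integral>\<^sup>+t. K t x \<partial>\<nu> \<partial>lborel)"
        by (rule Fubini'[symmetric]) measurable
      also have "\<dots> \<le> T"
        unfolding T_def by (intro nn_integral_mono K_le)
      finally show ?thesis .
    qed
    have "(\<integral>\<^sup>+x. ennreal_powr (\<integral>\<^sup>+t. ennreal_powr (ball_avg (\<rho> t) (G t) x) Q \<partial>\<nu>) (P / Q) \<partial>lborel)
      \<le> (\<integral>\<^sup>+x. ennreal_powr (L x) (1 - b) * ennreal_powr (ennreal_powr (2 ^ DIM('a)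
          * max_fun S x) P) (1 - (1 - b)) \<partial>lborel)"
    proof (rule nn_integral_mono)
      fix x
      have "(\<integral>\<^sup>+t. ennreal_powr (ball_avg (\<rho> t) (G t) x) Q \<partial>\<nu>)
        \<le> (\<integral>\<^sup>+t. ball_avg (\<rho> t) (K t) x * ennreal_powr (2 ^ DIM('a) * max_fun S x) (b * Q) \<partial>\<nu>)"
        by (intro nn_integral_mono_AE) (use avg_le AE_space in eventually_elim, simp)
      also have "\<dots> = L x * ennreal_powr (2 ^ DIM('a) * max_fun S x) (b * Q)"
        unfolding L_def by (rule nn_integral_multc) measurable
      finally have "ennreal_powr (\<integral>\<^sup>+t. ennreal_powr (ball_avg (\<rho> t) (G t) x) Q \<partial>\<nu>) (P / Q)
        \<le> ennreal_powr (L x * ennreal_powr (2 ^ DIM('a) * max_fun S x) (b * Q)) (P / Q)"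
        using P Q by (intro ennreal_powr_mono) auto
      also have "b * Q * (1 - b) = P * b" using P Q by (simp add: b_def)
      then have "ennreal_powr (L x * ennreal_powr (2 ^ DIM('a) * max_fun S x) (b * Q)) (P / Q)
         = ennreal_powr (L x) (1 - b) * ennreal_powr (ennreal_powr (2 ^ DIM('a)
             * max_fun S x) P) (1 - (1 - b))"
        by (simp only: ennreal_powr_mult ennreal_powr_powr b(3)) simp
      finally show "ennreal_powr (\<integral>\<^sup>+t. ennreal_powr (ball_avg (\<rho> t) (G t) x) Q \<partial>\<nu>) (P / Q)
         \<le> ennreal_powr (L x) (1 - b) * ennreal_powr (ennreal_powr (2 ^ DIM('a)
             * max_fun S x) P) (1 - (1 - b))" .
    qed
    also have "\<dots> \<le> ennreal_powr (\<integral>\<^sup>+x. L x \<partial>lborel) (1 - b) *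
       ennreal_powr (\<integral>\<^sup>+x. ennreal_powr (2 ^ DIM('a) * max_fun S x) P \<partial>lborel) (1 - (1 - b))"
      using b by (intro nn_integral_Hoelder) auto
    also have "\<dots> \<le> ennreal_powr T (1 - b) * ennreal_powr (ennreal (max_const DIM('a) P)
        * T) (1 - (1 - b))"
    proof (intro mult_mono ennreal_powr_mono L_le)
      have "T = (\<integral>\<^sup>+x. ennreal_powr (S x) P \<partial>lborel)"
        by (simp add: T_def S_def ennreal_powr_powr)
      then show "(\<integral>\<^sup>+x. ennreal_powr (2 ^ DIM('a) * max_fun S x) P \<partial>lborel)
          \<le> ennreal (max_const DIM('a) P) * T"
        using P by (simp add: nn_integral_max_fun_powr_le)
    qed (use b in auto)
    also have "\<dots> = ennreal_powr (ennreal (max_const DIM('a) P)) b * (ennreal_powr T (1 - b)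
        * ennreal_powr T b)"
      by (simp add: ennreal_powr_mult ac_simps)
    also have "\<dots> = ennreal (max_const DIM('a) P powr b) * T"
      using b max_const_pos[OF P, of "DIM('a)"]
      by (simp add: ennreal_powr_add[symmetric] ennreal_powr_ennreal)
    finally show ?thesis by (simp add: T_def V_def b_def)
  qed
qed

text \<open>The endpoint Q = infinity: the majorant does not depend on \<open>t\<close>, and its
  maximal function absorbs every radius. The exceptional set of \<open>t\<close> is the same for all
  \<open>x\<close>.\<close>

lemma ball_avg_family_le_max_fun:
  assumes [measurable]: "S \<in> borel_measurable borel"
    and le: "AE x in lborel. AE t in \<nu>. G t x \<le> S x"
  shows "AE t in \<nu>. \<forall>x. ball_avg (\<rho> t) (G t) x \<le> 2 ^ DIM('a) * max_fun S x"
proof -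
  have "AE t in \<nu>. AE x in lborel. G t x \<le> S x"
    by (subst AE_commute) (use le in \<open>measurable\<close>)
  then show ?thesis
    by eventually_elim (intro allI order_trans[OF ball_avg_mono_AE ball_avg_le_max_fun] assms)
qed

end


section \<open>Pointwise domination by averages\<close>

lemma ball_subset_ballI: "dist z x + \<rho> \<le> \<sigma> \<Longrightarrow> ball z \<rho> \<subseteq> ball x \<sigma>"
proof
  fix y assume "dist z x + \<rho> \<le> \<sigma>" "y \<in> ball z \<rho>"
  then show "y \<in> ball x \<sigma>"
    using dist_triangle[of x y z] by (simp add: dist_commute)
qed

text \<open>A continuous covering: the sum over balls of radius t/2 becomes an integral over centres
  z in \<open>B\<close> of the mean m(z) = \<open>ball_avg (t / 2) H z\<close>. The embedding of
  sequence spaces becomes m = m^(1-\<kappa>) m^\<kappa>, with the first factor bounded by a supremum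
  over \<open>B\<close>. It is applied with \<kappa> = M/r.\<close>

lemma wide_integral_le:
  fixes H :: "'a::euclidean_space \<Rightarrow> ennreal"
  assumes [measurable]: "H \<in> borel_measurable borel"
    and t: "0 < t" and lam: "1 < lam" and \<kappa>: "0 < \<kappa>" "\<kappa> < 1"
  shows "ennreal (t powr (- real DIM('a))) * (\<integral>\<^sup>+y\<in>ball x (lam * t). H y \<partial>lborel)
    \<le> ennreal (unit_ball_vol (real DIM('a))) * ennreal_powr
         (ennreal ((12 * lam) ^ DIM('a)) * ball_avg (3 * lam
             * t) (\<lambda>w. ennreal_powr (ball_avg t H w) \<kappa>) x) (1 / \<kappa>)"
proof -
  define D where "D = DIM('a)"
  define c where "c = unit_ball_vol (real D)"
  have c: "0 < c" by (simp add: c_def)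
  define h where "h w = ennreal_powr (ball_avg t H w) \<kappa>" for w
  have [measurable]: "h \<in> borel_measurable borel" 
    unfolding h_def by measurable
  define A where "A = ball_avg (3 * lam * t) h x"
  \<comment> \<open>\<open>J\<close> bounds m^\<kappa> uniformly on \<open>B\<close>. The 12 is 2 *
    6: \<open>local\<close> loses 2^d, and 6 lam is the ratio of the radii 3 lam t and t/2.\<close>
  define J where "J = ennreal ((12 * lam) ^ D) * A"
  \<comment> \<open>Large enough to contain the t/2-neighbourhood of
    \<open>ball x (lam * t)\<close>; its own t/2-neighbourhood stays in
    \<open>ball x (3 * lam * t)\<close> because lam > 1.\<close>
  define B where "B = ball x ((lam + 1) * t)"
  have [measurable]: "B \<in> sets borel" by (simp add: B_def)
  \<comment> \<open>For w within t/2 of z, \<open>ball z (t / 2)\<close> lies in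
    \<open>ball w t\<close>. So every such w bounds the mean at z, and the bound can be averaged
    over w.\<close>
  have local: "ennreal_powr (ball_avg (t / 2) H z) \<kappa> \<le> ennreal (2 ^ D) * ball_avg (t / 2) h z" for z
  proof -
    have "ennreal_powr (ball_avg (t / 2) H z) \<kappa> \<le> ball_avg (t / 2) (\<lambda>w. ennreal (2 ^ D) * h w) z"
    proof (rule le_ball_avg)
      fix w assume "w \<in> ball z (t / 2)"
      then have "ball_avg (t / 2) H z \<le> ennreal ((t / (t / 2)) ^ D) * ball_avg t H w"
        unfolding D_def using t by (intro ball_avg_subset_le ball_subset_ballI) auto
      then have "ennreal_powr (ball_avg (t / 2) H z) \<kappa>
          \<le> ennreal_powr (ennreal (2 ^ D) * ball_avg t H w) \<kappa>"
        using t \<kappa> by (intro ennreal_powr_mono) auto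
      also have "\<dots> = ennreal ((2 ^ D) powr \<kappa>) * h w"
        by (simp add: ennreal_powr_mult ennreal_powr_ennreal h_def del: ennreal_power ennreal_numeral)
      also have "\<dots> \<le> ennreal (2 ^ D) * h w"
      proof -
        have "((2::real) ^ D) powr \<kappa> \<le> (2 ^ D) powr 1"
          using \<kappa> by (intro powr_mono) auto
        then show ?thesis by (intro mult_right_mono ennreal_leI) auto
      qed
      finally show "ennreal_powr (ball_avg (t / 2) H z) \<kappa> \<le> ennreal (2 ^ D) * h w" .
    qed (use t in auto)
    also have "\<dots> = ennreal (2 ^ D) * ball_avg (t / 2) h z"
      by (simp add: ball_avg_density nn_integral_cmult)
    finally show ?thesis .
  qed
  have glob: "ennreal_powr (ball_avg (t / 2) H z) \<kappa> \<le> J" if "z \<in> B" for z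
  proof -
    have "dist z x + t / 2 \<le> 3 * lam * t"
    proof -
      have "dist z x \<le> (lam + 1) * t" using that by (simp add: B_def dist_commute)
      moreover have "(lam + 1) * t + t / 2 \<le> 3 * lam * t" using t lam by (simp add: field_simps)
      ultimately show ?thesis by linarith
    qed
    then have "ball_avg (t / 2) h z \<le> ennreal ((3 * lam * t / (t / 2)) ^ D) * A"
      unfolding A_def D_def using t lam by (intro ball_avg_subset_le ball_subset_ballI) auto
    also have "3 * lam * t / (t / 2) = 6 * lam" using t by simp
    finally have "ennreal (2 ^ D) * ball_avg (t / 2) h z
        \<le> ennreal (2 ^ D) * (ennreal ((6 * lam) ^ D) * A)"
      by (intro mult_left_mono) auto
    also have "\<dots> = J"
    proof -
      have "ennreal (2 ^ D) * ennreal ((6 * lam) ^ D) = ennreal (2 ^ D * (6 * lam) ^ D)"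
        using lam by (intro ennreal_mult[symmetric]) auto
      also have "2 ^ D * (6 * lam) ^ D = (12 * lam) ^ D"
        by (subst power_mult_distrib[symmetric]) simp
      finally show ?thesis by (simp only: J_def mult.assoc[symmetric])
    qed
    finally show ?thesis using local[of z] by (rule order_trans[rotated])
  qed
  have B_avg: "ball_avg (t / 2) (indicator B) y \<le> indicator (ball x (3 * lam * t)) y" for y
  proof (cases "y \<in> ball x (3 * lam * t)")
    case True
    have "ball_avg (t / 2) (indicator B) y \<le> ball_avg (t / 2) (\<lambda>_. 1) y"
      by (rule ball_avg_mono) (simp add: indicator_def)
    also have "\<dots> \<le> 1" by (rule ball_avg_const_le)
    finally show ?thesis using True by simp
  next
    case False
    have "w \<notin> B" if "w \<in> ball y (t / 2)" for w
    proof
      assume "w \<in> B"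
      then have "dist x y < (lam + 1) * t + t / 2"
        using that dist_triangle[of x y w] by (auto simp: B_def dist_commute)
      moreover have "(lam + 1) * t + t / 2 \<le> 3 * lam * t" using t lam by (simp add: field_simps)
      ultimately show False using False by auto
    qed
    then have "ball_kernel (t / 2) y w * indicator B w = 0" for w
      by (auto simp: ball_kernel_def indicator_def)
    then have "ball_avg (t / 2) (indicator B) y = 0"
      unfolding ball_avg_def by (simp only: nn_integral_const mult_zero_left)
    then show ?thesis by simp
  qed
  \<comment> \<open>The t/2-average of the indicator of \<open>B\<close> is at least 1 on
    \<open>ball x (lam * t)\<close>; self-adjointness then trades \<open>H\<close> for its local
    means on \<open>B\<close>.\<close>
  have "(\<integral>\<^sup>+y\<in>ball x (lam * t). H y \<partial>lborel) \<le> (\<integral>\<^sup>+y. H y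
      * ball_avg (t / 2) (indicator B) y \<partial>lborel)"
  proof (rule nn_integral_mono, rule mult_left_mono)
    fix y
    show "indicator (ball x (lam * t)) y \<le> ball_avg (t / 2) (indicator B) y"
    proof (cases "y \<in> ball x (lam * t)")
      case True
      have "ball y (t / 2) \<subseteq> B"
        using True t unfolding B_def by (intro ball_subset_ballI) (simp add: dist_commute field_simps)
      then have "1 \<le> ball_avg (t / 2) (indicator B) y"
        using t by (intro le_ball_avg) (auto simp: indicator_def)
      then show ?thesis using True by simp
    qed simp
  qed simp
  also have "\<dots> = (\<integral>\<^sup>+y. ball_avg (t / 2) H y * indicator B y \<partial>lborel)"
    by (rule nn_integral_ball_avg[symmetric]) measurable
  also have "\<dots> \<le> (\<integral>\<^sup>+z. ennreal_powr J ((1 - \<kappa>) / \<kappa>) * ennreal (2 ^ D) * (ball_avg (t / 2) h z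
      * indicator B z) \<partial>lborel)"
  proof (rule nn_integral_mono)
    fix z
    show "ball_avg (t / 2) H z * indicator B z
      \<le> ennreal_powr J ((1 - \<kappa>) / \<kappa>) * ennreal (2 ^ D) * (ball_avg (t / 2) h z * indicator B z)"
    proof (cases "z \<in> B")
      case True
      let ?m = "ball_avg (t / 2) H z"
      have "?m = ennreal_powr ?m ((1 - \<kappa>) + \<kappa>)" by simp
      also have "\<dots> = ennreal_powr ?m (1 - \<kappa>) * ennreal_powr ?m \<kappa>"
        using \<kappa> by (intro ennreal_powr_add) auto
      also have "\<dots> = ennreal_powr (ennreal_powr ?m \<kappa>) ((1 - \<kappa>) / \<kappa>) * ennreal_powr ?m \<kappa>"
        using \<kappa> by (simp add: ennreal_powr_powr)
      also have "\<dots> \<le> ennreal_powr J ((1 - \<kappa>) / \<kappa>) * (ennreal (2 ^ D) * ball_avg (t / 2) h z)"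
        using \<kappa> by (intro mult_mono ennreal_powr_mono glob True local) auto
      finally show ?thesis using True by (simp add: mult.assoc)
    qed simp
  qed
  also have "\<dots> = ennreal_powr J ((1 - \<kappa>) / \<kappa>) * ennreal (2 ^ D) * (\<integral>\<^sup>+z. ball_avg (t / 2) h z
      * indicator B z \<partial>lborel)"
    by (rule nn_integral_cmult) measurable
  also have "(\<integral>\<^sup>+z. ball_avg (t / 2) h z * indicator B z \<partial>lborel)
      = (\<integral>\<^sup>+z. h z * ball_avg (t / 2) (indicator B) z \<partial>lborel)"
    by (rule nn_integral_ball_avg) measurable
  also have "\<dots> \<le> (\<integral>\<^sup>+z\<in>ball x (3 * lam * t). h z \<partial>lborel)"
    by (intro nn_integral_mono mult_left_mono B_avg) auto
  also have "\<dots> = ennreal (c * (3 * lam * t) ^ D) * A"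
  proof -
    have v: "emeasure lborel (ball x (3 * lam * t))
        = ennreal (c * (3 * lam * t) ^ D)" "0 < c * (3 * lam * t) ^ D"
      using lam t c by (auto simp: emeasure_ball c_def D_def)
    then have "ennreal (c * (3 * lam * t) ^ D) * inverse (ennreal (c * (3 * lam * t) ^ D)) = 1"
      by (intro ennreal_mult_inverse_self)
    then show ?thesis
      unfolding A_def by (simp add: ball_avg_altdef v(1) mult.assoc[symmetric])
  qed
  finally have "ennreal (t powr (- real D)) * (\<integral>\<^sup>+y\<in>ball x (lam * t). H y \<partial>lborel)
    \<le> ennreal (t powr (- real D)) * (ennreal_powr J ((1 - \<kappa>) / \<kappa>) * ennreal (2 ^ D) * (ennreal (c
        * (3 * lam * t) ^ D) * A))"
    by (simp add: mult_left_mono)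
  also have "\<dots> = ennreal_powr J ((1 - \<kappa>) / \<kappa>) * (ennreal (t powr (- real D)) * ennreal (2 ^ D)
      * ennreal (c * (3 * lam * t) ^ D)) * A"
    by (simp only: ac_simps)
  also have "ennreal (t powr (- real D)) * ennreal (2 ^ D) * ennreal (c * (3 * lam * t) ^ D)
      = ennreal (c * (6 * lam) ^ D)"
  proof -
    have "t powr (- real D) = (1 / t) ^ D"
      using t by (simp add: powr_minus powr_realpow power_one_over inverse_eq_divide)
    then have "t powr (- real D) * 2 ^ D * (c * (3 * lam * t) ^ D)
        = c * (1 / t * 2 * (3 * lam * t)) ^ D"
      by (simp only: power_mult_distrib ac_simps)
    also have "1 / t * 2 * (3 * lam * t) = 6 * lam" using t by simp
    finally show ?thesis using c t lam by (simp only: ennreal_mult[symmetric] mult_nonneg_nonneg powr_ge_zero zero_le_power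
         zero_le_numeral less_imp_le)
  qed
  \<comment> \<open>Raising 6 to 12 completes the last factor to \<open>J\<close>, so that the
    exponents (1 - \<kappa>)/\<kappa> and 1 add up to 1/\<kappa>.\<close>
  also have "ennreal_powr J ((1 - \<kappa>) / \<kappa>) * ennreal (c * (6 * lam) ^ D) * A
     \<le> ennreal_powr J ((1 - \<kappa>) / \<kappa>) * ennreal (c * (12 * lam) ^ D) * A"
    using c lam by (intro mult_right_mono mult_left_mono ennreal_leI power_mono) auto
  also have "\<dots> = ennreal c * (ennreal_powr J ((1 - \<kappa>) / \<kappa>) * ennreal_powr J 1)"
    using c lam unfolding J_def by (subst ennreal_mult) (auto simp: ac_simps)
  also have "\<dots> = ennreal c * ennreal_powr J (1 / \<kappa>)"
  proof -
    have "(1 - \<kappa>) / \<kappa> + 1 = 1 / \<kappa>" using \<kappa> by (simp add: field_simps)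
    then show ?thesis using \<kappa> by (simp add: ennreal_powr_add[symmetric] del: ennreal_powr_1)
  qed
  finally show ?thesis
    by (simp add: c_def D_def J_def A_def h_def[abs_def])
qed

section \<open>Essential suprema over boxes\<close>

definition box_sup :: "(real \<times> 'a::euclidean_space \<Rightarrow> ennreal) \<Rightarrow> real \<Rightarrow> real \<Rightarrow> 'a \<Rightarrow> ennreal" where
  "box_sup u t \<rho> x = esssup (lebesgue_on ({t/2<..t} \<times> ball x \<rho>)) u"

lemma AE_lebesgue_on_iff:
  assumes "S \<in> sets borel" "{x. P x} \<in> sets borel"
  shows "(AE x in lebesgue_on S. P x) \<longleftrightarrow> (AE x in lborel. x \<in> S \<longrightarrow> P x)"
  using assms by (simp add: AE_restrict_space_iff AE_completion_iff)

text \<open>Turns arguments about essential suprema into almost-everywhere bounds for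
  \<open>lborel\<close>, where null sets can be united and Tonelli is available.\<close>

lemma esssup_lebesgue_on_le_iff:
  fixes u :: "'b::euclidean_space \<Rightarrow> ennreal"
  assumes [measurable]: "u \<in> borel_measurable borel" "S \<in> sets borel"
  shows "esssup (lebesgue_on S) u \<le> c \<longleftrightarrow> (AE p in lborel. p \<in> S \<longrightarrow> u p \<le> c)"
proof -
  have "u \<in> borel_measurable lebesgue"
    by (rule measurable_completion) simp
  then have meas: "u \<in> borel_measurable (lebesgue_on S)"
    by (rule measurable_restrict_space1)
  have "esssup (lebesgue_on S) u \<le> c \<longleftrightarrow> (AE p in lebesgue_on S. u p \<le> c)"
    using esssup_I[OF meas] esssup_AE[of u "lebesgue_on S"]
    by (auto elim!: eventually_mono intro: order_trans)
  also have "\<dots> \<longleftrightarrow> (AE p in lborel. p \<in> S \<longrightarrow> u p \<le> c)"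
    by (intro AE_lebesgue_on_iff) auto
  finally show ?thesis .
qed

lemma box_sup_le_iff:
  fixes u :: "real \<times> 'a::euclidean_space \<Rightarrow> ennreal"
  assumes "u \<in> borel_measurable borel"
  shows "box_sup u t \<rho> x \<le> c \<longleftrightarrow> (AE p in lborel. p \<in> {t/2<..t} \<times> ball x \<rho> \<longrightarrow> u p \<le> c)"
  unfolding box_sup_def using assms by (intro esssup_lebesgue_on_le_iff borel_Times) auto

text \<open>The supremum is at most c exactly when the points of the box with u > c form a null set.
  The volume of this set is a parameter integral, hence measurable in the parameters.\<close>

lemma borel_measurable_box_sup:
  fixes u :: "real \<times> 'a::euclidean_space \<Rightarrow> ennreal"
  assumes u [measurable]: "u \<in> borel_measurable borel"
    and [measurable]: "\<tau> \<in> borel_measurable N" "\<rho> \<in> borel_measurable N" "f \<in> borel_measurable N"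
  shows "(\<lambda>w. box_sup u (\<tau> w) (\<rho> w) (f w)) \<in> borel_measurable N"
proof (rule borel_measurableI_le)
  fix c
  have [measurable]: "u \<in> borel_measurable (lborel \<Otimes>\<^sub>M lborel)"
    using u by (simp add: lborel_prod)
  define B where "B w = {p. (\<tau> w / 2 < fst p \<and> fst p
      \<le> \<tau> w \<and> dist (f w) (snd p) < \<rho> w) \<and> c < u p}" for w
  have "box_sup u (\<tau> w) (\<rho> w) (f w) \<le> c \<longleftrightarrow> (\<integral>\<^sup>+p. indicator (B w) p \<partial>(lborel \<Otimes>\<^sub>M lborel)) = 0" for w
  proof -
    have "(indicator (B w) :: _ \<Rightarrow> ennreal) \<in> borel_measurable (lborel \<Otimes>\<^sub>M lborel)"
      unfolding B_def indicator_def mem_Collect_eq by measurable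
    then have "(\<integral>\<^sup>+p. indicator (B w) p \<partial>(lborel \<Otimes>\<^sub>M lborel)) = 0
        \<longleftrightarrow> (AE p in lborel \<Otimes>\<^sub>M lborel. p \<notin> B w)"
      by (subst nn_integral_0_iff_AE) (auto simp: indicator_def)
    also have "\<dots> \<longleftrightarrow> (AE p in lborel. p \<in> {\<tau> w/2<..\<tau> w} \<times> ball (f w) (\<rho> w) \<longrightarrow> u p \<le> c)"
      unfolding lborel_prod by (intro AE_cong) (auto simp: B_def)
    finally show ?thesis by (simp add: box_sup_le_iff u)
  qed
  moreover have "(\<lambda>w. \<integral>\<^sup>+p. indicator (B w) p \<partial>(lborel \<Otimes>\<^sub>M lborel)) \<in> borel_measurable N"
    unfolding B_def indicator_def mem_Collect_eq by measurable
  ultimately show "{w \<in> space N. box_sup u (\<tau> w) (\<rho> w) (f w) \<le> c} \<in> sets N"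
    by simp
qed

text \<open>The counterpart of \<open>wide_integral_le\<close> for r = infinity. A supremum over
  many small boxes costs no counting; the factor 6 lam is the ratio of the radii 3 lam t and
  t/2.\<close>

lemma box_sup_wide_le:
  fixes u :: "real \<times> 'a::euclidean_space \<Rightarrow> ennreal"
  assumes u [measurable]: "u \<in> borel_measurable borel"
    and t: "0 < t" and lam: "1 < lam" and M: "0 < M"
  shows "box_sup u t (lam * t) x
    \<le> ennreal_powr (ennreal ((6 * lam) ^ DIM('a)) *
         ball_avg (3 * lam * t) (\<lambda>w. ennreal_powr (box_sup u t t w) M) x) (1 / M)"
proof -
  define h where "h w = ennreal_powr (box_sup u t t w) M" for w
  have [measurable]: "h \<in> borel_measurable borel"
    unfolding h_def by (intro borel_measurable_ennreal_powr borel_measurable_box_sup) auto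
  define c where "c = ennreal_powr (ennreal ((6 * lam) ^ DIM('a)) * ball_avg (3 * lam
      * t) h x) (1 / M)"
  have local: "AE p in lborel. p \<in> {t/2<..t} \<times> ball z (t / 2)
      \<longrightarrow> u p \<le> c" if z: "z \<in> ball x (lam * t)" for z
  proof -
    have "ennreal_powr (box_sup u t (t / 2) z) M \<le> ball_avg (t / 2) h z"
    proof (rule le_ball_avg)
      fix w assume w: "w \<in> ball z (t / 2)"
      have sub: "ball z (t / 2) \<subseteq> ball w t"
        using w by (intro ball_subset_ballI) auto
      have "AE p in lborel. p \<in> {t/2<..t} \<times> ball w t \<longrightarrow> u p \<le> box_sup u t t w"
        by (subst box_sup_le_iff[symmetric]) auto
      then have "box_sup u t (t / 2) z \<le> box_sup u t t w"
        using sub by (subst box_sup_le_iff) (auto elim!: eventually_mono)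
      then show "ennreal_powr (box_sup u t (t / 2) z) M \<le> h w"
        unfolding h_def using M by (intro ennreal_powr_mono) auto
    qed (use t in simp)
    also have "\<dots> \<le> ennreal ((3 * lam * t / (t / 2)) ^ DIM('a)) * ball_avg (3 * lam * t) h x"
    proof (intro ball_avg_subset_le ball_subset_ballI)
      have "dist z x \<le> lam * t" using z by (simp add: dist_commute)
      moreover have "lam * t + t / 2 \<le> 3 * lam * t" using t lam by (simp add: field_simps)
      ultimately show "dist z x + t / 2 \<le> 3 * lam * t" by linarith
    qed (use t lam in auto)
    also have "3 * lam * t / (t / 2) = 6 * lam" using t by simp
    finally have "box_sup u t (t / 2) z \<le> c"
      unfolding c_def by (simp only: ennreal_powr_le_iff[OF M])
    then show ?thesis by (simp only: box_sup_le_iff[OF u])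
  qed
  \<comment> \<open>With countably many centres the union of the exceptional sets stays null, while
    the balls of radius t/2 about them still cover.\<close>
  obtain Z :: "'a set" where Z: "countable Z" "\<And>U. open U \<Longrightarrow> U \<noteq> {} \<Longrightarrow> \<exists>z\<in>Z. z \<in> U"
    using countable_dense_setE by blast
  have "AE p in lborel. \<forall>z\<in>Z \<inter> ball x (lam * t). p \<in> {t/2<..t} \<times> ball z (t / 2) \<longrightarrow> u p \<le> c"
    using Z(1) local by (intro AE_ball_countable[THEN iffD2]) auto
  then have "AE p in lborel. p \<in> {t/2<..t} \<times> ball x (lam * t) \<longrightarrow> u p \<le> c"
  proof eventually_elim
    case (elim p)
    show ?case
    proof
      assume p: "p \<in> {t/2<..t} \<times> ball x (lam * t)"
      then have "snd p \<in> ball x (lam * t) \<inter> ball (snd p) (t / 2)" using t by auto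
      then obtain z where "z \<in> Z" "z \<in> ball x (lam * t) \<inter> ball (snd p) (t / 2)"
        using Z(2)[of "ball x (lam * t) \<inter> ball (snd p) (t / 2)"] by blast
      with elim p show "u p \<le> c"
        by (auto simp: dist_commute mem_Times_iff)
    qed
  qed
  then show ?thesis
    by (simp only: box_sup_le_iff[OF u] c_def h_def[abs_def])
qed


section \<open>Inner expressions for a Borel function\<close>

definition slab :: "real \<Rightarrow> (real \<times> 'a::euclidean_space \<Rightarrow> ennreal) \<Rightarrow> real \<Rightarrow> 'a \<Rightarrow> ennreal" where
  "slab a u t y = (\<integral>\<^sup>+s\<in>{t/2<..t}. ennreal_powr (u (s, y)) a \<partial>lborel) / ennreal (t / 2)"

text \<open>Here \<open>u\<close> stands for \<open>weighted_abs \<beta> f\<close>, and the mean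
  over s is taken first, inside \<open>slab\<close>, so that for finite r a spatial average of a
  single function remains.\<close>

definition inner_fun :: "ennreal \<Rightarrow> (real \<times> 'a::euclidean_space \<Rightarrow> ennreal) \<Rightarrow> 'a \<Rightarrow> real \<Rightarrow> ennreal" where
  "inner_fun r u x t = (if r = \<infinity> then box_sup u t t x
     else ennreal_powr (ball_avg t (slab (enn2real r) u t) x) (1 / enn2real r))"

definition wide_fun :: "real \<Rightarrow> ennreal \<Rightarrow> (real \<times> 'a::euclidean_space \<Rightarrow> ennreal) \<Rightarrow> 'a \<Rightarrow> real \<Rightarrow> ennreal" where
  "wide_fun lam r u x t = (if r = \<infinity> then box_sup u t (lam * t) x
     else ennreal_powr (ennreal (t powr (- real DIM('a))) *
       (\<integral>\<^sup>+y\<in>ball x (lam * t). slab (enn2real r) u t y \<partial>lborel)) (1 / enn2real r))"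

lemma borel_measurable_slab [measurable]:
  fixes u :: "real \<times> 'a::euclidean_space \<Rightarrow> ennreal"
  assumes u: "u \<in> borel_measurable borel"
    and [measurable]: "\<tau> \<in> borel_measurable N" "f \<in> borel_measurable N"
  shows "(\<lambda>w. slab a u (\<tau> w) (f w)) \<in> borel_measurable N"
proof -
  have [measurable]: "u \<in> borel_measurable (borel \<Otimes>\<^sub>M borel)"
    using u by (simp add: borel_prod)
  show ?thesis
    unfolding slab_def indicator_def greaterThanAtMost_iff by measurable
qed

lemma borel_measurable_inner_fun [measurable]:
  fixes u :: "real \<times> 'a::euclidean_space \<Rightarrow> ennreal"
  assumes [measurable]: "u \<in> borel_measurable borel" "\<tau> \<in> borel_measurable N" "f \<in> borel_measurable N"
  shows "(\<lambda>w. inner_fun r u (f w) (\<tau> w)) \<in> borel_measurable N"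
proof (cases "r = \<infinity>")
  case True
  then show ?thesis by (simp add: inner_fun_def borel_measurable_box_sup)
next
  case False
  have "(\<lambda>w. ball_avg (\<tau> w) (slab (enn2real r) u (\<tau> w)) (f w)) \<in> borel_measurable N"
    by (rule borel_measurable_ball_avg; measurable)
  then show ?thesis using False by (simp add: inner_fun_def)
qed

lemma borel_measurable_wide_fun [measurable]:
  fixes u :: "real \<times> 'a::euclidean_space \<Rightarrow> ennreal"
  assumes [measurable]: "u \<in> borel_measurable borel"
  shows "wide_fun lam r u x \<in> borel_measurable borel"
proof (cases "r = \<infinity>")
  case True
  then show ?thesis by (simp add: wide_fun_def[abs_def] borel_measurable_box_sup)
next
  case False
  have "(\<lambda>t. \<integral>\<^sup>+y\<in>ball x (lam * t). slab (enn2real r) u t y \<partial>lborel) \<in> borel_measurable borel"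
    unfolding indicator_def mem_ball by measurable
  then show ?thesis using False by (simp add: wide_fun_def[abs_def])
qed

section \<open>Reduction to Borel functions\<close>

text \<open>Extended by 0 off the half-space, the weighted modulus is Lebesgue measurable on the
  whole space and so agrees almost everywhere with a Borel function.\<close>

lemma ex_borel_representative:
  assumes f: "f \<in> borel_measurable (lebesgue_on upper_half_space)"
  shows "\<exists>u\<in>borel_measurable borel. AE p in lborel. 0 < fst p \<longrightarrow> ennreal (weighted_abs \<beta> f p) = u p"
proof -
  let ?H = "upper_half_space :: (real \<times> (real ^ 'n)) set"
  have H: "?H \<in> sets borel"
    unfolding upper_half_space_def by (intro borel_Times) auto
  have "fst \<in> borel_measurable (lborel :: (real \<times> (real ^ 'n)) measure)"
    by (simp add: borel_prod[symmetric])
  then have fst: "fst \<in> borel_measurable (lebesgue_on ?H)"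
    by (intro measurable_restrict_space1 measurable_completion)
  have w: "weighted_abs \<beta> f = (\<lambda>p. cmod (of_real (fst p powr (- \<beta>)) * f p))"
    by (auto simp: weighted_abs_def)
  have "(\<lambda>p. ennreal (weighted_abs \<beta> f p)) \<in> borel_measurable (lebesgue_on ?H)"
    unfolding w using f fst by measurable
  then have "(\<lambda>p. if p \<in> ?H then ennreal (weighted_abs \<beta> f p) else 0) \<in> borel_measurable lebesgue"
    using H by (subst (asm) measurable_restrict_space_iff[where c = 0]) auto
  then obtain u where "u \<in> borel_measurable lborel"
      "AE p in lborel. (if p \<in> ?H then ennreal (weighted_abs \<beta> f p) else 0) = u p"
    using completion_ex_borel_measurable by blast
  moreover from this have "AE p in lborel. 0 < fst p \<longrightarrow> ennreal (weighted_abs \<beta> f p) = u p"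
    by (elim eventually_mono) (auto simp: upper_half_space_def mem_Times_iff split: if_splits)
  ultimately show ?thesis by auto
qed

lemma emeasure_lebesgue_borel: "S \<in> sets borel \<Longrightarrow> emeasure lebesgue S = emeasure lborel S"
  by (simp add: emeasure_completion)

context
  fixes f :: "real \<times> (real ^ 'n) \<Rightarrow> complex" and \<beta> :: real and u :: "real \<times> (real ^ 'n) \<Rightarrow> ennreal"
  assumes f: "f \<in> borel_measurable (lebesgue_on upper_half_space)"
    and u [measurable]: "u \<in> borel_measurable borel"
    and ae: "AE p in lborel. 0 < fst p \<longrightarrow> ennreal (weighted_abs \<beta> f p) = u p"
begin

lemma representative_pair_measurable: "u \<in> borel_measurable (borel \<Otimes>\<^sub>M borel)" "u \<in> borel_measurable (lborel \<Otimes>\<^sub>M lborel)"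
  using u by (simp_all add: borel_prod lborel_prod)

lemma esssup_weighted_abs:
  assumes t: "0 < t"
  shows "esssup (lebesgue_on ({t/2<..t} \<times> ball x \<rho>)) (\<lambda>z. ennreal (weighted_abs \<beta> f z))
      = box_sup u t \<rho> x"
proof -
  let ?S = "{t/2<..t} \<times> ball x \<rho>"
  have S: "?S \<in> sets borel" "?S \<subseteq> upper_half_space"
    using t by (auto simp: upper_half_space_def intro!: borel_Times)
  have "fst \<in> borel_measurable (lborel :: (real \<times> (real ^ 'n)) measure)"
    by (simp add: borel_prod[symmetric])
  then have fst: "fst \<in> borel_measurable (lebesgue_on ?S)"
    by (intro measurable_restrict_space1 measurable_completion)
  have f': "f \<in> borel_measurable (lebesgue_on ?S)"
    by (rule measurable_restrict_mono[OF f S(2)])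
  have "weighted_abs \<beta> f = (\<lambda>p. cmod (of_real (fst p powr (- \<beta>)) * f p))"
    by (auto simp: weighted_abs_def)
  then have 1: "(\<lambda>p. ennreal (weighted_abs \<beta> f p)) \<in> borel_measurable (lebesgue_on ?S)"
    using f' fst by simp
  have 2: "u \<in> borel_measurable (lebesgue_on ?S)"
    by (intro measurable_restrict_space1 measurable_completion) simp
  have "AE p in lborel. p \<in> ?S \<longrightarrow> ennreal (weighted_abs \<beta> f p) = u p"
    using ae t by (elim eventually_mono) auto
  then have "AE p in lebesgue_on ?S. ennreal (weighted_abs \<beta> f p) = u p"
    using S by (simp add: AE_restrict_space_iff AE_completion_iff)
  with 1 2 show ?thesis
    unfolding box_sup_def by (rule esssup_AE_cong)
qed

text \<open>Almost every slice of a null set is null, with exceptional s independent of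
  \<open>B\<close>. As \<open>nn_integral_completion\<close> covers arbitrary integrands, slices of
  \<open>f\<close> can be passed to \<open>lborel\<close> directly.\<close>

lemma AE_slice_integral:
  "AE s in lborel. 0 < s \<longrightarrow> (\<forall>B. (\<integral>\<^sup>+y\<in>B. ennreal (weighted_abs \<beta> f (s, y) powr a) \<partial>lebesgue)
     = (\<integral>\<^sup>+y\<in>B. ennreal_powr (u (s, y)) a \<partial>lborel))"
proof -
  have "AE p in lborel \<Otimes>\<^sub>M lborel. 0 < fst p \<longrightarrow> ennreal (weighted_abs \<beta> f p) = u p"
    using ae unfolding lborel_prod .
  then have "AE s in lborel. AE y in lborel. 0 < fst (s, y)
      \<longrightarrow> ennreal (weighted_abs \<beta> f (s, y)) = u (s, y)"
    by (rule lborel_pair.AE_pair)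
  then show ?thesis
  proof eventually_elim
    case (elim s)
    show ?case
    proof (intro impI allI)
      fix B :: "(real ^ 'n) set"
      assume s: "0 < s"
      have nonneg: "0 \<le> weighted_abs \<beta> f (s, y)" for y by (simp add: weighted_abs_def)
      show "(\<integral>\<^sup>+y\<in>B. ennreal (weighted_abs \<beta> f (s, y) powr a) \<partial>lebesgue)
        = (\<integral>\<^sup>+y\<in>B. ennreal_powr (u (s, y)) a \<partial>lborel)"
        unfolding nn_integral_completion using elim s
        by (intro nn_integral_cong_AE, elim eventually_mono)
           (auto simp: ennreal_powr_ennreal[OF nonneg, symmetric])
    qed
  qed
qed

text \<open>The free constant \<open>c\<close> covers both normalisations, the reciprocal ball
  volume and t^(-d). The interchange of integrals takes place after passing to
  \<open>u\<close>.\<close>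

lemma mean_integral_slices:
  assumes t: "0 < t" and [measurable]: "B \<in> sets borel"
  shows "mean_integral {t/2<..t} (\<lambda>s. c * (\<integral>\<^sup>+y\<in>B. ennreal (weighted_abs \<beta> f (s, y) powr a) \<partial>lebesgue))
    = c * (\<integral>\<^sup>+y\<in>B. slab a u t y \<partial>lborel)"
proof -
  note [measurable] = representative_pair_measurable
  have "(\<integral>\<^sup>+s\<in>{t/2<..t}. c * (\<integral>\<^sup>+y\<in>B. ennreal (weighted_abs \<beta> f (s, y) powr a) \<partial>lebesgue) \<partial>lebesgue)
    = (\<integral>\<^sup>+s. c * (\<integral>\<^sup>+y. ennreal_powr (u (s, y)) a * indicator {t/2<..t} s
        * indicator B y \<partial>lborel) \<partial>lborel)"
    unfolding nn_integral_completion[of _ "\<lambda>s. c * _ s * indicator _ s"]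
  proof (intro nn_integral_cong_AE)
    show "AE s in lborel. c * (\<integral>\<^sup>+y\<in>B. ennreal (weighted_abs \<beta> f (s, y) powr a) \<partial>lebesgue)
        * indicator {t/2<..t} s
      = c * (\<integral>\<^sup>+y. ennreal_powr (u (s, y)) a * indicator {t/2<..t} s * indicator B y \<partial>lborel)"
      using AE_slice_integral[of a]
    proof eventually_elim
      case (elim s)
      then show ?case using t by (cases "s \<in> {t/2<..t}") auto
    qed
  qed
  also have "\<dots> = c * (\<integral>\<^sup>+s. \<integral>\<^sup>+y. ennreal_powr (u (s, y)) a * indicator {t/2<..t} s
      * indicator B y \<partial>lborel \<partial>lborel)"
    by (rule nn_integral_cmult) measurable
  also have "(\<integral>\<^sup>+s. \<integral>\<^sup>+y. ennreal_powr (u (s, y)) a * indicator {t/2<..t} s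
      * indicator B y \<partial>lborel \<partial>lborel)
    = (\<integral>\<^sup>+y. \<integral>\<^sup>+s. ennreal_powr (u (s, y)) a * indicator {t/2<..t} s
        * indicator B y \<partial>lborel \<partial>lborel)"
    by (rule lborel_pair.Fubini'[symmetric]) measurable
  also have "\<dots> = (\<integral>\<^sup>+y\<in>B. (\<integral>\<^sup>+s\<in>{t/2<..t}. ennreal_powr (u (s, y)) a \<partial>lborel) \<partial>lborel)"
    by (intro nn_integral_cong nn_integral_multc) measurable
  finally have "mean_integral {t/2<..t} (\<lambda>s. c
      * (\<integral>\<^sup>+y\<in>B. ennreal (weighted_abs \<beta> f (s, y) powr a) \<partial>lebesgue))
    = c * (\<integral>\<^sup>+y\<in>B. (\<integral>\<^sup>+s\<in>{t/2<..t}. ennreal_powr (u (s, y)) a \<partial>lborel) \<partial>lborel) / ennreal (t / 2)"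
    unfolding mean_integral_def using t by (simp add: emeasure_lebesgue_borel)
  also have "\<dots> = c * ((\<integral>\<^sup>+y\<in>B. (\<integral>\<^sup>+s\<in>{t/2<..t}. ennreal_powr (u (s, y)) a \<partial>lborel) \<partial>lborel) / ennreal (t / 2))"
    by (simp add: divide_ennreal_def mult.assoc)
  also have "(\<integral>\<^sup>+y\<in>B. (\<integral>\<^sup>+s\<in>{t/2<..t}. ennreal_powr (u (s, y)) a \<partial>lborel) \<partial>lborel) / ennreal (t / 2)
    = (\<integral>\<^sup>+y. (\<integral>\<^sup>+s\<in>{t/2<..t}. ennreal_powr (u (s, y)) a \<partial>lborel)
        * indicator B y / ennreal (t / 2) \<partial>lborel)"
    by (rule nn_integral_divide[symmetric]) measurable
  also have "\<dots> = (\<integral>\<^sup>+y\<in>B. slab a u t y \<partial>lborel)"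
    by (simp add: slab_def divide_ennreal_def ac_simps)
  finally show ?thesis .
qed

lemma tent_inner_eq: "0 < t \<Longrightarrow> tent_inner r \<beta> f x t = inner_fun r u x t"
proof (cases "r = \<infinity>")
  case False
  assume t: "0 < t"
  let ?v = "inverse (emeasure lborel (ball x t))"
  have "mean_integral {t/2<..t} (\<lambda>s. mean_integral (ball x t) (\<lambda>y. ennreal (weighted_abs \<beta> f (s, y) powr enn2real r)))
    = mean_integral {t/2<..t} (\<lambda>s. ?v * (\<integral>\<^sup>+y\<in>ball x t. ennreal (weighted_abs \<beta> f (s, y) powr enn2real r) \<partial>lebesgue))"
    by (simp add: mean_integral_def[of "ball x t"] divide_ennreal_def emeasure_lebesgue_borel mult.commute)
  also have "\<dots> = ?v * (\<integral>\<^sup>+y\<in>ball x t. slab (enn2real r) u t y \<partial>lborel)"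
    using t by (intro mean_integral_slices) auto
  also have "\<dots> = ball_avg t (slab (enn2real r) u t) x"
    by (rule ball_avg_altdef[symmetric]) measurable
  finally show ?thesis using False by (simp add: tent_inner_def inner_fun_def)
qed (simp add: tent_inner_def inner_fun_def esssup_weighted_abs)

lemma tent_inner_wide_eq: "0 < t \<Longrightarrow> tent_inner_wide lam r \<beta> f x t = wide_fun lam r u x t"
  by (auto simp: tent_inner_wide_def wide_fun_def esssup_weighted_abs mean_integral_slices)

end

section \<open>Mixed norms\<close>

text \<open>Carried by the whole line, so that functions of t can be plain Borel functions; at t <=
  0 the density is 0 / 0 = 0.\<close>

definition dt_over_t :: "real measure" where
  "dt_over_t = density lborel (\<lambda>t. indicator {0<..} t / ennreal t)"

lemma sets_dt_over_t [measurable_cong]: "sets dt_over_t = sets borel"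
  by (simp add: dt_over_t_def)

lemma sigma_finite_dt_over_t: "sigma_finite_measure dt_over_t"
  unfolding dt_over_t_def
proof (subst sigma_finite_measure.sigma_finite_iff_density_finite[OF sigma_finite_lborel])
  show "AE t in lborel. indicator {0<..} t / ennreal t \<noteq> \<infinity>"
    by (rule AE_I2) (simp add: indicator_def ennreal_divide_eq_top_iff)
qed measurable

lemma AE_dt_over_t: "(AE t in dt_over_t. P t) \<longleftrightarrow> (AE t in lborel. 0 < t \<longrightarrow> P t)"
proof -
  have "0 < indicator {0<..} t / ennreal t \<longleftrightarrow> 0 < t" for t :: real
    by (simp add: indicator_def ennreal_zero_less_divide)
  then show ?thesis
    unfolding dt_over_t_def by (subst AE_density) simp_all
qed

lemma vertical_norm_finite:
  assumes "q \<noteq> \<infinity>" and [measurable]: "G \<in> borel_measurable borel"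
  shows "vertical_norm q G
    = ennreal_powr (\<integral>\<^sup>+t. ennreal_powr (G t) (enn2real q) \<partial>dt_over_t) (1 / enn2real q)"
proof -
  have "(\<integral>\<^sup>+t. ennreal_powr (G t) (enn2real q) \<partial>dt_over_t)
    = (\<integral>\<^sup>+t. indicator {0<..} t / ennreal t * ennreal_powr (G t) (enn2real q) \<partial>lborel)"
    unfolding dt_over_t_def by (rule nn_integral_density) measurable
  also have "\<dots> = (\<integral>\<^sup>+t\<in>{0<..}. ennreal_powr (G t) (enn2real q) / ennreal t \<partial>lebesgue)"
    unfolding nn_integral_completion divide_ennreal_def by (simp only: ac_simps)
  finally show ?thesis using assms(1) by (simp only: vertical_norm_def if_False)
qed

text \<open>On the positive half-line dt/t and Lebesgue measure have the same null sets.\<close>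

lemma vertical_norm_infinity_le_iff:
  assumes "G \<in> borel_measurable borel"
  shows "vertical_norm \<infinity> G \<le> c \<longleftrightarrow> (AE t in dt_over_t. G t \<le> c)"
proof -
  have "vertical_norm \<infinity> G \<le> c \<longleftrightarrow> (AE t in lborel. t \<in> {0<..} \<longrightarrow> G t \<le> c)"
    unfolding vertical_norm_def using esssup_lebesgue_on_le_iff[OF assms, of "{0<..}" c] by simp
  then show ?thesis by (simp only: AE_dt_over_t greaterThan_iff)
qed

text \<open>The identities of \<open>tent_inner\<close> with \<open>inner_fun\<close> hold at
  positive t only. As \<open>esssup\<close> depends on the measurability of its argument,
  measurability is transferred from \<open>G\<close> as well.\<close>

lemma vertical_norm_cong:
  assumes eq: "\<And>t. 0 < t \<Longrightarrow> F t = G t" and G [measurable]: "G \<in> borel_measurable borel"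
  shows "vertical_norm q F = vertical_norm q G"
proof -
  have "G \<in> borel_measurable (lebesgue_on {0<..})"
    by (intro measurable_restrict_space1 measurable_completion) simp
  moreover have "F \<in> borel_measurable (lebesgue_on {0<..})
      \<longleftrightarrow> G \<in> borel_measurable (lebesgue_on {0<..})"
    by (rule measurable_cong) (simp add: eq)
  moreover have "AE t in lebesgue_on {0<..}. F t = G t"
    by (rule AE_I2) (simp add: eq)
  ultimately have "esssup (lebesgue_on {0<..}) F = esssup (lebesgue_on {0<..}) G"
    by (simp only: esssup_AE_cong)
  moreover have "(\<integral>\<^sup>+t\<in>{0<..}. ennreal_powr (F t) a / ennreal t \<partial>lebesgue)
    = (\<integral>\<^sup>+t\<in>{0<..}. ennreal_powr (G t) a / ennreal t \<partial>lebesgue)" for a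
  proof (rule nn_integral_cong)
    fix t :: real
    show "ennreal_powr (F t) a / ennreal t * indicator {0<..} t
        = ennreal_powr (G t) a / ennreal t * indicator {0<..} t"
      by (cases "0 < t") (simp_all add: eq)
  qed
  ultimately show ?thesis by (simp only: vertical_norm_def)
qed

text \<open>For P >= Q, Jensen moves the power Q inside the average, which leaves the outer exponent
  P/Q on an integral of averages. \<open>C\<close> is chosen before the radii, so it is later
  independent of lam.\<close>

lemma ex_ball_avg_family_const:
  assumes P: "1 < P" and Q: "1 < Q"
  shows "\<exists>C>0. \<forall>(\<rho>::real \<Rightarrow> real) (G::real \<Rightarrow> 'a::euclidean_space \<Rightarrow> ennreal).
    \<rho> \<in> borel_measurable dt_over_t \<longrightarrow> (\<lambda>(t, y). G t y) \<in> borel_measurable (dt_over_t \<Otimes>\<^sub>M lborel) \<longrightarrow>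
    (\<integral>\<^sup>+x. ennreal_powr (\<integral>\<^sup>+t. ennreal_powr (ball_avg (\<rho> t) (G t) x) Q \<partial>dt_over_t) (P / Q) \<partial>lborel)
    \<le> ennreal C * (\<integral>\<^sup>+x. ennreal_powr (\<integral>\<^sup>+t. ennreal_powr (G t x) Q \<partial>dt_over_t) (P / Q) \<partial>lborel)"
proof (cases "P < Q")
  case True
  show ?thesis
    by (intro exI[of _ "max_const DIM('a) P powr (1 - P / Q)"] conjI allI impI
         nn_integral_ball_avg_family_powr_powr_le sigma_finite_dt_over_t P True)
       (use max_const_pos[OF P, of "DIM('a)"] in auto)
next
  case False
  define C where "C = (if P = Q then 1 else max_const DIM('a) (P / Q / (P / Q - 1)) powr (P / Q - 1))"
  have pos: "0 < C"
  proof (cases "P = Q")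
    case False
    with \<open>\<not> P < Q\<close> Q have "1 < P / Q" by (simp add: field_simps)
    moreover have "1 < x / (x - 1)" if "1 < x" for x :: real
      using that by (simp add: field_simps)
    ultimately have "1 < P / Q / (P / Q - 1)" by blast
    then show ?thesis using False max_const_pos[of "P / Q / (P / Q - 1)" "DIM('a)"]
        by (simp add: C_def)
  qed (simp add: C_def)
  show ?thesis
  proof (intro exI[of _ C] conjI allI impI pos)
    fix \<rho> :: "real \<Rightarrow> real" and G :: "real \<Rightarrow> 'a \<Rightarrow> ennreal"
    assume \<rho> [measurable]: "\<rho> \<in> borel_measurable dt_over_t"
      and G [measurable]: "(\<lambda>(t, y). G t y) \<in> borel_measurable (dt_over_t \<Otimes>\<^sub>M lborel)"
    define GQ where "GQ t y = ennreal_powr (G t y) Q" for t y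
    have GQ: "(\<lambda>(t, y). GQ t y) \<in> borel_measurable (dt_over_t \<Otimes>\<^sub>M lborel)"
      unfolding GQ_def by measurable
    have G_t: "G t \<in> borel_measurable borel" for t
      using measurable_Pair2[OF G, of t] by (simp add: dt_over_t_def)
    have "(\<integral>\<^sup>+x. ennreal_powr (\<integral>\<^sup>+t. ennreal_powr (ball_avg (\<rho> t) (G t) x) Q \<partial>dt_over_t) (P / Q) \<partial>lborel)
      \<le> (\<integral>\<^sup>+x. ennreal_powr (\<integral>\<^sup>+t. ball_avg (\<rho> t) (GQ t) x \<partial>dt_over_t) (P / Q) \<partial>lborel)"
      unfolding GQ_def using P Q
      by (intro nn_integral_mono ennreal_powr_mono ball_avg_Jensen G_t) auto
    also have "\<dots> \<le> ennreal C * (\<integral>\<^sup>+x. ennreal_powr (\<integral>\<^sup>+t. GQ t x \<partial>dt_over_t) (P / Q) \<partial>lborel)"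
    proof (cases "P = Q")
      case True
      then show ?thesis
        using Q nn_integral_ball_avg_family_le[OF sigma_finite_dt_over_t \<rho> GQ] by (simp add: C_def)
    next
      case neq: False
      with False Q have "1 < P / Q" by (simp add: field_simps)
      from nn_integral_ball_avg_family_powr_le[OF sigma_finite_dt_over_t \<rho> GQ this]
      show ?thesis using neq by (simp add: C_def)
    qed
    finally show "(\<integral>\<^sup>+x. ennreal_powr (\<integral>\<^sup>+t. ennreal_powr (ball_avg (\<rho> t) (G t) x) Q \<partial>dt_over_t) (P / Q) \<partial>lborel)
      \<le> ennreal C * (\<integral>\<^sup>+x. ennreal_powr (\<integral>\<^sup>+t. ennreal_powr (G t x) Q \<partial>dt_over_t) (P / Q) \<partial>lborel)"
      by (simp add: GQ_def)
  qed
qed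

text \<open>The M-th root of the volume factor (12 lam)^d or (6 lam)^d gives lam^(d/M). For finite
  r, \<kappa> = M/r converts the mean inside the root 1/r into the M-th power of the inner
  expression.\<close>

lemma ex_wide_fun_le:
  assumes M: "0 < M" and r: "ennreal M < r"
  shows "\<exists>C>0. \<forall>(u :: real \<times> 'a::euclidean_space \<Rightarrow> ennreal) lam t x. u \<in> borel_measurable borel
      \<longrightarrow> 1 < lam \<longrightarrow> 0 < t \<longrightarrow>
    wide_fun lam r u x t \<le> ennreal (C * lam powr (real DIM('a) / M)) *
      ennreal_powr (ball_avg (3 * lam * t) (\<lambda>w. ennreal_powr (inner_fun r u w t) M) x) (1 / M)"
proof (cases "r = \<infinity>")
  case True
  define C where "C = (6::real) powr (real DIM('a) / M)"
  have "wide_fun lam r u x t \<le> ennreal (C * lam powr (real DIM('a) / M)) *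
      ennreal_powr (ball_avg (3 * lam * t) (\<lambda>w. ennreal_powr (inner_fun r u w t) M) x) (1 / M)"
    if "u \<in> borel_measurable borel" "1 < lam" "0 < t" for u :: "real \<times> 'a \<Rightarrow> ennreal" and lam t x
  proof -
    have "((6 * lam) ^ DIM('a)) powr (1 / M) = C * lam powr (real DIM('a) / M)"
      using that by (simp add: C_def powr_realpow[symmetric] powr_powr powr_mult del: powr_realpow)
    then show ?thesis
      using box_sup_wide_le[OF that(1,3,2) M, of x] that True
      by (simp add: wide_fun_def inner_fun_def ennreal_powr_mult ennreal_powr_ennreal del: ennreal_power)
  qed
  moreover have "0 < C" by (simp add: C_def)
  ultimately show ?thesis by blast
next
  case False
  define R where "R = enn2real r"
  have R: "M < R" using r M False
    by (cases r) (auto simp: R_def ennreal_less_iff)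
  define \<kappa> where "\<kappa> = M / R"
  have \<kappa>: "0 < \<kappa>" "\<kappa> < 1" "1 / \<kappa> * (1 / R) = 1 / M" "1 / R * M = \<kappa>"
    using M R by (auto simp: \<kappa>_def)
  define V where "V = unit_ball_vol (real DIM('a))"
  have V: "0 < V" by (simp add: V_def)
  define C where "C = V powr (1 / R) * 12 powr (real DIM('a) / M)"
  have "wide_fun lam r u x t \<le> ennreal (C * lam powr (real DIM('a) / M)) *
      ennreal_powr (ball_avg (3 * lam * t) (\<lambda>w. ennreal_powr (inner_fun r u w t) M) x) (1 / M)"
    if [measurable]: "u \<in> borel_measurable borel" and lam: "1 < lam" and t: "0 < t"
    for u :: "real \<times> 'a \<Rightarrow> ennreal" and lam t x
  proof -
    let ?A = "ball_avg (3 * lam * t) (\<lambda>w. ennreal_powr (ball_avg t (slab R u t) w) \<kappa>) x"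
    have "ennreal_powr (inner_fun r u w t) M = ennreal_powr (ball_avg t (slab R u t) w) \<kappa>" for w
      using False \<kappa>(4) by (simp add: inner_fun_def R_def ennreal_powr_powr)
    moreover have "wide_fun lam r u x t \<le> ennreal (C * lam powr (real DIM('a) / M))
        * ennreal_powr ?A (1 / M)"
    proof -
      have "wide_fun lam r u x t
        \<le> ennreal_powr (ennreal V * ennreal_powr (ennreal ((12 * lam) ^ DIM('a))
            * ?A) (1 / \<kappa>)) (1 / R)"
        unfolding wide_fun_def R_def[symmetric] V_def if_not_P[OF False]
        by (intro ennreal_powr_mono wide_integral_le t lam \<kappa>) (use M R in auto)
      also have "\<dots> = ennreal (V powr (1 / R)) * (ennreal (((12 * lam) ^ DIM('a)) powr (1 / M))
          * ennreal_powr ?A (1 / M))"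
        unfolding ennreal_powr_mult ennreal_powr_powr \<kappa>(3) using V lam
        by (simp only: ennreal_powr_ennreal less_imp_le zero_le_power mult_nonneg_nonneg
            zero_le_numeral less_trans[OF zero_less_one])
      also have "((12 * lam) ^ DIM('a)) powr (1 / M)
          = 12 powr (real DIM('a) / M) * lam powr (real DIM('a) / M)"
        using lam by (simp add: powr_realpow[symmetric] powr_powr powr_mult del: powr_realpow)
      finally show ?thesis
        using V by (simp add: C_def ennreal_mult mult.assoc)
    qed
    ultimately show ?thesis by simp
  qed
  moreover have "0 < C" using V by (simp add: C_def)
  ultimately show ?thesis by blast
qed

lemma Lp_norm_wide_fun_le:
  fixes p M :: real and q r :: ennreal
  assumes p: "M < p" and q: "ennreal M < q" and r: "ennreal M < r" and M: "0 < M"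
  shows "\<exists>C>0. \<forall>lam (u :: real \<times> (real ^ 'n) \<Rightarrow> ennreal). 1 < lam \<longrightarrow> u \<in> borel_measurable borel \<longrightarrow>
    Lp_norm p (\<lambda>x. vertical_norm q (wide_fun lam r u x))
      \<le> ennreal (C * lam powr (real CARD('n) / M))
          * Lp_norm p (\<lambda>x. vertical_norm q (inner_fun r u x))"
proof -
  define P where "P = p / M"
  have P: "1 < P" using p M by (simp add: P_def)
  obtain C1 where C1: "0 < C1" and wide_le: "\<And>(u :: real \<times> (real ^ 'n) \<Rightarrow> ennreal) lam t x.
    u \<in> borel_measurable borel \<Longrightarrow> 1 < lam \<Longrightarrow> 0 < t \<Longrightarrow>
    wide_fun lam r u x t \<le> ennreal (C1 * lam powr (real CARD('n) / M)) *
      ennreal_powr (ball_avg (3 * lam * t) (\<lambda>w. ennreal_powr (inner_fun r u w t) M) x) (1 / M)"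
    using ex_wide_fun_le[OF M r, where 'a = "real ^ 'n"] by auto
  \<comment> \<open>The measurable majorant \<open>A\<close> is a common interface for finite and
    infinite q, and it lets constants be pulled out of the integral over x.\<close>
  have "\<exists>C2>0. \<forall>lam (u :: real \<times> (real ^ 'n) \<Rightarrow> ennreal). 1 < lam \<longrightarrow> u \<in> borel_measurable borel \<longrightarrow>
    (\<exists>A. A \<in> borel_measurable borel
      \<and> (\<forall>x. vertical_norm q (wide_fun lam r u x)
          \<le> ennreal (C1 * lam powr (real CARD('n) / M)) * A x)
      \<and> (\<integral>\<^sup>+x. ennreal_powr (A x) p \<partial>lborel)
          \<le> ennreal C2 * (\<integral>\<^sup>+x. ennreal_powr (vertical_norm q (inner_fun r u x)) p \<partial>lborel))"
  proof (cases "q = \<infinity>")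
    case True
    show ?thesis
    proof (intro exI[of _ "max_const CARD('n) P"] conjI allI impI max_const_pos P)
      fix lam :: real and u :: "real \<times> (real ^ 'n) \<Rightarrow> ennreal"
      assume lam: "1 < lam" and u [measurable]: "u \<in> borel_measurable borel"
      define K where "K = ennreal (C1 * lam powr (real CARD('n) / M))"
      define S where "S y = vertical_norm q (inner_fun r u y)" for y
      interpret sigma_finite_measure dt_over_t by (rule sigma_finite_dt_over_t)
      have S_le_iff: "S y \<le> c \<longleftrightarrow> (AE t in dt_over_t. inner_fun r u y t \<le> c)" for y c
        unfolding S_def True by (rule vertical_norm_infinity_le_iff) measurable
      \<comment> \<open>As for \<open>box_sup\<close>: a sublevel set is the zero set of a parameter
        integral.\<close>
      have [measurable]: "S \<in> borel_measurable borel"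
      proof (rule borel_measurableI_le)
        fix c
        have "S y \<le> c \<longleftrightarrow> (\<integral>\<^sup>+t. indicator {t. c < inner_fun r u y t} t \<partial>dt_over_t) = 0" for y
          unfolding S_le_iff
          by (subst nn_integral_0_iff_AE) (auto simp: indicator_def not_less intro!: AE_cong)
        moreover have "(\<lambda>y. \<integral>\<^sup>+t. indicator {t. c < inner_fun r u y t} t \<partial>dt_over_t) \<in> borel_measurable borel"
          unfolding indicator_def mem_Collect_eq by measurable
        ultimately show "{y \<in> space borel. S y \<le> c} \<in> sets borel"
          by simp
      qed
      define SM where "SM y = ennreal_powr (S y) M" for y
      have [measurable]: "SM \<in> borel_measurable borel" unfolding SM_def by measurable
      define A where "A x = ennreal_powr (2 ^ CARD('n) * max_fun SM x) (1 / M)" for x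
      have "AE t in dt_over_t. \<forall>x. ball_avg (3 * lam * t) (\<lambda>w. ennreal_powr (inner_fun r u w t) M) x
        \<le> 2 ^ DIM(real ^ 'n) * max_fun SM x"
      proof (rule ball_avg_family_le_max_fun[OF sigma_finite_dt_over_t])
        have "AE t in dt_over_t. ennreal_powr (inner_fun r u y t) M \<le> SM y" for y
          using S_le_iff[of y "S y"] M by (auto simp: SM_def elim!: eventually_mono intro: ennreal_powr_mono)
        then show "AE y in lborel. AE t in dt_over_t. ennreal_powr (inner_fun r u y t) M \<le> SM y"
          by simp
      qed measurable
      moreover have "AE t in dt_over_t. 0 < t" by (simp add: AE_dt_over_t)
      ultimately have "AE t in dt_over_t. \<forall>x. wide_fun lam r u x t \<le> K * A x"
      proof eventually_elim
        case (elim t)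
        show ?case
        proof
          fix x
          have "wide_fun lam r u x t \<le> K * ennreal_powr (ball_avg (3 * lam
              * t) (\<lambda>w. ennreal_powr (inner_fun r u w t) M) x) (1 / M)"
            unfolding K_def using elim by (intro wide_le lam u) auto
          also have "\<dots> \<le> K * A x"
            unfolding A_def using elim M by (intro mult_left_mono ennreal_powr_mono) auto
          finally show "wide_fun lam r u x t \<le> K * A x" .
        qed
      qed
      then have "AE t in dt_over_t. wide_fun lam r u x t \<le> K * A x" for x
        by (rule eventually_mono) simp
      then have "vertical_norm q (wide_fun lam r u x) \<le> K * A x" for x
        unfolding True by (subst vertical_norm_infinity_le_iff) measurable
      moreover have "A \<in> borel_measurable borel"
        unfolding A_def by measurable
      moreover have "(\<integral>\<^sup>+x. ennreal_powr (A x) p \<partial>lborel)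
          \<le> ennreal (max_const CARD('n) P) * (\<integral>\<^sup>+x. ennreal_powr (S x) p \<partial>lborel)"
        using nn_integral_max_fun_powr_le[of SM P] P M
        by (simp add: A_def SM_def ennreal_powr_powr P_def)
      ultimately show "\<exists>A. A \<in> borel_measurable borel
        \<and> (\<forall>x. vertical_norm q (wide_fun lam r u x)
            \<le> ennreal (C1 * lam powr (real CARD('n) / M)) * A x)
        \<and> (\<integral>\<^sup>+x. ennreal_powr (A x) p \<partial>lborel)
          \<le> ennreal (max_const CARD('n) P) * (\<integral>\<^sup>+x. ennreal_powr (vertical_norm q (inner_fun r u x)) p \<partial>lborel)"
        unfolding K_def[symmetric] S_def[symmetric] by blast
    qed
  next
    case False
    define Q0 where "Q0 = enn2real q"
    have Q0: "M < Q0" using q M False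
      by (cases q) (auto simp: Q0_def ennreal_less_iff)
    define Q where "Q = Q0 / M"
    have Q: "1 < Q" using Q0 M by (simp add: Q_def)
    have PQ: "1 / Q0 * p = P / Q" using M Q0 by (simp add: P_def Q_def)
    obtain C2 where C2: "0 < C2" and avg_le: "\<And>\<rho> (G :: real \<Rightarrow> real ^ 'n \<Rightarrow> ennreal).
      \<rho> \<in> borel_measurable dt_over_t \<Longrightarrow> (\<lambda>(t, y). G t y) \<in> borel_measurable (dt_over_t \<Otimes>\<^sub>M lborel) \<Longrightarrow>
      (\<integral>\<^sup>+x. ennreal_powr (\<integral>\<^sup>+t. ennreal_powr (ball_avg (\<rho> t) (G t) x) Q \<partial>dt_over_t) (P / Q) \<partial>lborel)
      \<le> ennreal C2 * (\<integral>\<^sup>+x. ennreal_powr (\<integral>\<^sup>+t. ennreal_powr (G t x) Q \<partial>dt_over_t) (P / Q) \<partial>lborel)"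
      using ex_ball_avg_family_const[OF P Q, where 'a = "real ^ 'n"] by blast
    show ?thesis
    proof (intro exI[of _ C2] conjI allI impI C2)
      fix lam :: real and u :: "real \<times> (real ^ 'n) \<Rightarrow> ennreal"
      assume lam: "1 < lam" and u [measurable]: "u \<in> borel_measurable borel"
      define K where "K = ennreal (C1 * lam powr (real CARD('n) / M))"
      \<comment> \<open>M-th powers turn the exponents p and \<open>Q0\<close> into \<open>P\<close>
        and \<open>Q\<close>: the Q-th power of \<open>G\<close> is the Q0-th power of the inner
        expression.\<close>
      define G where "G t y = ennreal_powr (inner_fun r u y t) M" for t y
      interpret sigma_finite_measure dt_over_t by (rule sigma_finite_dt_over_t)
      have G [measurable]: "(\<lambda>(t, y). G t y) \<in> borel_measurable (dt_over_t \<Otimes>\<^sub>M lborel)"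
        unfolding G_def by measurable
      have \<rho> [measurable]: "(\<lambda>t. 3 * lam * t) \<in> borel_measurable dt_over_t" by measurable
      note [measurable] = borel_measurable_ball_avg_family[OF sigma_finite_dt_over_t \<rho> G]
      define I where "I x = (\<integral>\<^sup>+t. ennreal_powr (ball_avg (3 * lam
          * t) (G t) x) Q \<partial>dt_over_t)" for x
      have [measurable]: "I \<in> borel_measurable borel" unfolding I_def by measurable
      define A where "A x = ennreal_powr (I x) (1 / Q0)" for x
      have "vertical_norm q (wide_fun lam r u x) \<le> K * A x" for x
      proof -
        have "(\<integral>\<^sup>+t. ennreal_powr (wide_fun lam r u x t) Q0 \<partial>dt_over_t)
          \<le> (\<integral>\<^sup>+t. ennreal_powr K Q0 * ennreal_powr (ball_avg (3 * lam * t) (G t) x) Q \<partial>dt_over_t)"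
        proof (intro nn_integral_mono_AE)
          have "AE t in dt_over_t. 0 < t" by (simp add: AE_dt_over_t)
          then show "AE t in dt_over_t. ennreal_powr (wide_fun lam r u x t) Q0
            \<le> ennreal_powr K Q0 * ennreal_powr (ball_avg (3 * lam * t) (G t) x) Q"
          proof eventually_elim
            case (elim t)
            have "ennreal_powr (wide_fun lam r u x t) Q0
                \<le> ennreal_powr (K * ennreal_powr (ball_avg (3 * lam * t) (G t) x) (1 / M)) Q0"
              unfolding K_def G_def using M Q0 elim by (intro ennreal_powr_mono wide_le lam u) auto
            then show ?case
              by (simp add: ennreal_powr_mult ennreal_powr_powr Q_def)
          qed
        qed
        also have "\<dots> = ennreal_powr K Q0 * I x"
          unfolding I_def by (rule nn_integral_cmult) measurable
        finally have "vertical_norm q (wide_fun lam r u x)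
            \<le> ennreal_powr (ennreal_powr K Q0 * I x) (1 / Q0)"
          using False M Q0 by (simp add: vertical_norm_finite Q0_def[symmetric] ennreal_powr_mono)
        also have "\<dots> = K * A x"
          using M Q0 by (simp add: A_def ennreal_powr_mult)
        finally show ?thesis .
      qed
      moreover have "A \<in> borel_measurable borel"
        unfolding A_def by measurable
      moreover have "(\<integral>\<^sup>+x. ennreal_powr (A x) p \<partial>lborel)
        \<le> ennreal C2 * (\<integral>\<^sup>+x. ennreal_powr (vertical_norm q (inner_fun r u x)) p \<partial>lborel)"
      proof -
        have "ennreal_powr (G t x) Q = ennreal_powr (inner_fun r u x t) Q0" for t x
          using M by (simp add: G_def Q_def ennreal_powr_powr)
        then have "ennreal_powr (vertical_norm q (inner_fun r u x)) p
           = ennreal_powr (\<integral>\<^sup>+t. ennreal_powr (G t x) Q \<partial>dt_over_t) (P / Q)" for x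
          using False by (simp add: vertical_norm_finite Q0_def[symmetric] ennreal_powr_powr PQ[simplified])
        moreover have "ennreal_powr (A x) p = ennreal_powr (I x) (P / Q)" for x
          using PQ by (simp only: A_def ennreal_powr_powr)
        ultimately show ?thesis
          using avg_le[OF \<rho> G] by (simp add: I_def)
      qed
      ultimately show "\<exists>A. A \<in> borel_measurable borel
        \<and> (\<forall>x. vertical_norm q (wide_fun lam r u x)
            \<le> ennreal (C1 * lam powr (real CARD('n) / M)) * A x)
        \<and> (\<integral>\<^sup>+x. ennreal_powr (A x) p \<partial>lborel)
          \<le> ennreal C2 * (\<integral>\<^sup>+x. ennreal_powr (vertical_norm q (inner_fun r u x)) p \<partial>lborel)"
        unfolding K_def[symmetric] by blast
    qed
  qed
  then obtain C2 where C2: "0 < C2" and dominated: "\<And>lam (u :: real \<times> (real ^ 'n) \<Rightarrow> ennreal). 1 < lam \<Longrightarrow> u \<in> borel_measurable borel \<Longrightarrow>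
    (\<exists>A. A \<in> borel_measurable borel
      \<and> (\<forall>x. vertical_norm q (wide_fun lam r u x)
          \<le> ennreal (C1 * lam powr (real CARD('n) / M)) * A x)
      \<and> (\<integral>\<^sup>+x. ennreal_powr (A x) p \<partial>lborel)
          \<le> ennreal C2 * (\<integral>\<^sup>+x. ennreal_powr (vertical_norm q (inner_fun r u x)) p \<partial>lborel))"
    by blast
  show ?thesis
  proof (intro exI[of _ "C1 * C2 powr (1 / p)"] conjI allI impI)
    show "0 < C1 * C2 powr (1 / p)" using C1 C2 by simp
    fix lam :: real and u :: "real \<times> (real ^ 'n) \<Rightarrow> ennreal"
    assume lam: "1 < lam" and u: "u \<in> borel_measurable borel"
    define K where "K = ennreal (C1 * lam powr (real CARD('n) / M))"
    define T where "T = (\<integral>\<^sup>+x. ennreal_powr (vertical_norm q (inner_fun r u x)) p \<partial>lborel)"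
    obtain A where A [measurable]: "A \<in> borel_measurable borel"
      and le: "\<And>x. vertical_norm q (wide_fun lam r u x) \<le> K * A x"
      and int: "(\<integral>\<^sup>+x. ennreal_powr (A x) p \<partial>lborel) \<le> ennreal C2 * T"
      using dominated[OF lam u] unfolding K_def T_def by blast
    have "(\<integral>\<^sup>+x. ennreal_powr (vertical_norm q (wide_fun lam r u x)) p \<partial>lborel)
      \<le> (\<integral>\<^sup>+x. ennreal_powr K p * ennreal_powr (A x) p \<partial>lborel)"
      unfolding ennreal_powr_mult[symmetric] using M p
          by (intro nn_integral_mono ennreal_powr_mono le) auto
    also have "\<dots> = ennreal_powr K p * (\<integral>\<^sup>+x. ennreal_powr (A x) p \<partial>lborel)"
      by (rule nn_integral_cmult) measurable
    also have "\<dots> \<le> ennreal_powr K p * (ennreal C2 * T)"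
      by (intro mult_left_mono int) auto
    finally have "Lp_norm p (\<lambda>x. vertical_norm q (wide_fun lam r u x))
        \<le> ennreal_powr (ennreal_powr K p * (ennreal C2 * T)) (1 / p)"
      unfolding Lp_norm_def nn_integral_completion using M p by (intro ennreal_powr_mono) auto
    also have "\<dots> = K * (ennreal (C2 powr (1 / p)) * ennreal_powr T (1 / p))"
      using M p C2 by (simp add: ennreal_powr_mult ennreal_powr_ennreal)
    also have "\<dots> = ennreal (C1 * C2 powr (1 / p) * lam powr (real CARD('n) / M))
        * ennreal_powr T (1 / p)"
      using C1 by (simp add: K_def ennreal_mult ac_simps)
    finally show "Lp_norm p (\<lambda>x. vertical_norm q (wide_fun lam r u x))
      \<le> ennreal (C1 * C2 powr (1 / p) * lam powr (real CARD('n) / M))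
          * Lp_norm p (\<lambda>x. vertical_norm q (inner_fun r u x))"
      by (simp add: T_def Lp_norm_def nn_integral_completion)
  qed
qed

text \<open>\<open>\<beta>\<close> enters only through the Borel representative \<open>u\<close>,
  over which the estimate is uniform; hence \<open>C\<close> can be chosen before
  \<open>\<beta>\<close>, \<open>lam\<close> and \<open>f\<close>.\<close>

theorem lemma3p9:
  fixes p M :: real and q r :: ennreal
  assumes "0 < p" and "0 < q" and "0 < r"
    and "0 < M" and "ennreal M < min (ennreal p) (min q r)"
  shows "\<exists>C>0. \<forall>(\<beta>::real) (lam::real) (f :: real \<times> (real ^ 'n) \<Rightarrow> complex).
           1 < lam \<longrightarrow> f \<in> borel_measurable (lebesgue_on upper_half_space) \<longrightarrow>
           Lp_norm p (\<lambda>x. vertical_norm q (tent_inner_wide lam r \<beta> f x))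
             \<le> ennreal (C * lam powr (real CARD('n) / M)) * tent_norm p q r \<beta> f"
proof -
  have "M < p" "ennreal M < q" "ennreal M < r"
    using assms by (auto simp: ennreal_less_iff)
  from Lp_norm_wide_fun_le[OF this \<open>0 < M\<close>, where 'n = 'n]
  obtain C where C: "0 < C" and le: "\<And>lam (u :: real \<times> (real ^ 'n) \<Rightarrow> ennreal). 1 < lam
      \<Longrightarrow> u \<in> borel_measurable borel \<Longrightarrow>
    Lp_norm p (\<lambda>x. vertical_norm q (wide_fun lam r u x))
      \<le> ennreal (C * lam powr (real CARD('n) / M))
          * Lp_norm p (\<lambda>x. vertical_norm q (inner_fun r u x))"
    by blast
  show ?thesis
  proof (intro exI[of _ C] conjI allI impI C)
    fix \<beta> lam :: real and f :: "real \<times> (real ^ 'n) \<Rightarrow> complex"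
    assume lam: "1 < lam" and f: "f \<in> borel_measurable (lebesgue_on upper_half_space)"
    obtain u where u [measurable]: "u \<in> borel_measurable borel"
      and ae: "AE p in lborel. 0 < fst p \<longrightarrow> ennreal (weighted_abs \<beta> f p) = u p"
      using ex_borel_representative[OF f] by blast
    have "vertical_norm q (tent_inner_wide lam r \<beta> f x)
        = vertical_norm q (wide_fun lam r u x)" for x
      by (rule vertical_norm_cong) (simp_all add: tent_inner_wide_eq[OF f u ae])
    moreover have "vertical_norm q (tent_inner r \<beta> f x) = vertical_norm q (inner_fun r u x)" for x
      by (rule vertical_norm_cong) (simp_all add: tent_inner_eq[OF f u ae])
    ultimately show "Lp_norm p (\<lambda>x. vertical_norm q (tent_inner_wide lam r \<beta> f x))
       \<le> ennreal (C * lam powr (real CARD('n) / M)) * tent_norm p q r \<beta> f"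
      using le[OF lam u] by (simp add: tent_norm_def)
  qed
qed

end
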